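(* Let $p$ be a prime with $p\equiv 1\pmod 4$. Then there exist infinitely many $\ell\in\mathbb{N}$ such that $\Gamma(4,p^{4\ell})$ and its complement $\bar\Gamma(4,p^{4\ell})$ are equienergetic.
   Context: For a prime power $q$ and $k\mid q-1$, let $R_k=\{x^k: x\in\mathbb{F}_q^*\}$. $\Gamma(k,q)$ is the graph on $\mathbb{F}_q$ in which $v,w$ are adjacent iff $w-v\in R_k$; $\bar\Gamma$ denotes the complement graph. The energy of a graph is the sum of the absolute values of its adjacency eigenvalues; equienergetic means equal energy. *)

theory Defs
  imports
    "HOL-Computational_Algebra.Primes"
    "HOL-Library.Countable_Set"
    "HOL-Algebra.Ring"
    "HOL-Number_Theory.Cong"
    "Graph_Theory.Pair_Digraph"
    "Jordan_Normal_Form.Char_Poly"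
begin

text \<open>
  A graph is represented by its vertex set and its set of arcs, an undirected edge being a pair of
  opposite arcs. The complement has no loops.
\<close>

definition complement_graph :: "'a pair_pre_digraph \<Rightarrow> 'a pair_pre_digraph" where
  "complement_graph G =
     \<lparr> pverts = pverts G,
       parcs = {(v, w) \<in> pverts G \<times> pverts G. v \<noteq> w \<and> (v, w) \<notin> parcs G} \<rparr>"

text \<open>
  For a finite vertex set, \<open>from_nat_into\<close> enumerates the vertices bijectively by
  \<open>0, \<dots>, card (pverts G) - 1\<close>. Another enumeration conjugates the matrix by a permutation matrix
  and so does not change its characteristic polynomial.
\<close>

definition adjacency_matrix :: "'a pair_pre_digraph \<Rightarrow> complex mat" where
  "adjacency_matrix G =
     mat (card (pverts G)) (card (pverts G))
       (\<lambda>(i, j). if (from_nat_into (pverts G) i, from_nat_into (pverts G) j) \<in> parcs G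
                 then 1 else 0)"

text \<open>
  The multiset of eigenvalues, with their multiplicities, consists of the roots of the
  characteristic polynomial. They are taken over the complex numbers, so that none is missed; for
  an undirected graph they are all real.
\<close>

definition graph_energy :: "'a pair_pre_digraph \<Rightarrow> real" where
  "graph_energy G = (\<Sum>\<mu>\<in>#proots (char_poly (adjacency_matrix G)). cmod \<mu>)"

definition equienergetic :: "'a pair_pre_digraph \<Rightarrow> 'b pair_pre_digraph \<Rightarrow> bool" where
  "equienergetic G H \<longleftrightarrow> graph_energy G = graph_energy H"

definition power_residues :: "nat \<Rightarrow> ('a, 'm) ring_scheme \<Rightarrow> 'a set" where
  "power_residues k F = {x [^]\<^bsub>F\<^esub> k | x. x \<in> carrier F - {\<zero>\<^bsub>F\<^esub>}}"

text \<open>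
  The graph \<open>\<Gamma>(k, q)\<close>, where the finite field \<open>F\<close> with \<open>q\<close> elements takes the place of \<open>q\<close>.
\<close>

definition residue_graph :: "nat \<Rightarrow> ('a, 'm) ring_scheme \<Rightarrow> 'a pair_pre_digraph" where
  "residue_graph k F =
     \<lparr> pverts = carrier F,
       parcs = {(v, w) \<in> carrier F \<times> carrier F. w \<ominus>\<^bsub>F\<^esub> v \<in> power_residues k F} \<rparr>"

end

theory Submission
  imports Defs "HOL-Algebra.Multiplicative_Group"
begin

text \<open>
  Let \<open>F\<close> have order \<open>q = p ^ (4 l)\<close> and put \<open>n = (q - 1) / 4\<close>. The additive characters diagonalise
  the adjacency matrices: \<open>\<Gamma>\<close> has the eigenvalue \<open>n\<close> and the four Gaussian periods \<open>\<eta>\<close>, each with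
  multiplicity \<open>n\<close>; the complement has \<open>3 n\<close> and the four values \<open>-1 - \<eta>\<close>. The energies agree iff
  the sum of \<open>\<bar>1 + \<eta>\<bar> - \<bar>\<eta>\<bar>\<close> over the four periods is \<open>-2\<close>, which holds if three periods are at
  most \<open>-1\<close> and one is nonnegative.

  Take \<open>l = 2 ^ k\<close>. Then \<open>F\<close> is the top of a tower of \<open>k + 2\<close> quadratic extensions over the prime
  field, and in each step a Gauss sum \<open>g\<close> becomes \<open>-g\<^sup>2\<close>. The quartic Gauss sum \<open>g\<close> of the prime
  field satisfies \<open>g ^ 4 = p \<pi>\<^sup>2\<close>, where the Jacobi sum \<open>\<pi>\<close> is a Gaussian integer of norm \<open>p\<close>. So
  the periods are determined by \<open>\<pi> ^ (2 l) / p ^ l\<close>, a point on the unit circle that is squared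
  when \<open>k\<close> increases by one, and the signs are as wanted iff its real part \<open>c\<close> satisfies
  \<open>\<bar>c\<bar> < 1/2\<close>. This happens for infinitely many \<open>k\<close>, because \<open>c\<close> follows the expanding map
  \<open>c \<mapsto> 2 c\<^sup>2 - 1\<close> and, as \<open>p\<close> does not divide its numerator, avoids the exceptional values 1 and \<open>-1/2\<close>.
\<close>

section \<open>The Frobenius map\<close>

lemma (in cring) binomial_expansion:
  assumes x: "x \<in> carrier R" and y: "y \<in> carrier R"
  shows "(x \<oplus> y) [^] (n::nat) =
    (\<Oplus>k\<in>{..n}. [(n choose k)] \<cdot> (x [^] k \<otimes> y [^] (n - k)))"
proof (induction n)
  case 0
  show ?case using x y by (simp add: add.nat_pow_eone)
next
  case (Suc n)
  let ?m = "\<lambda>i j. x [^] (i::nat) \<otimes> y [^] (j::nat)"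
  have [simp]: "?m i j \<in> carrier R" for i j using x y by simp
  have X: "x \<otimes> (\<Oplus>k\<in>{..n}. [(n choose k)] \<cdot> ?m k (n - k))
      = (\<Oplus>k\<in>{..n}. [(n choose k)] \<cdot> ?m (Suc k) (n - k))"
    using x y
    by (subst finsum_rdistr) (auto intro!: finsum_cong' simp: add_pow_rdistr m_ac)
  have Y: "y \<otimes> (\<Oplus>k\<in>{..n}. [(n choose k)] \<cdot> ?m k (n - k))
      = (\<Oplus>k\<in>{..Suc n}. [(n choose k)] \<cdot> ?m k (Suc n - k))"
  proof -
    have "y \<otimes> (\<Oplus>k\<in>{..n}. [(n choose k)] \<cdot> ?m k (n - k))
        = (\<Oplus>k\<in>{..n}. [(n choose k)] \<cdot> ?m k (Suc n - k))"
      using x y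
      by (subst finsum_rdistr)
        (auto intro!: finsum_cong' simp: add_pow_rdistr Suc_diff_le m_ac)
    \<comment> \<open>The added term \<open>k = Suc n\<close> has coefficient 0. With it, splitting
      off \<open>k = 0\<close> aligns this sum with the shifted one from \<open>X\<close>, and
      Pascal's rule applies.\<close>
    also have "\<dots> = (\<Oplus>k\<in>{..Suc n}. [(n choose k)] \<cdot> ?m k (Suc n - k))"
      by (subst finsum_Suc) (use x y in \<open>auto simp: binomial_eq_0\<close>)
    finally show ?thesis .
  qed
  have "(x \<oplus> y) [^] Suc n = x \<otimes> (x \<oplus> y) [^] n \<oplus> y \<otimes> (x \<oplus> y) [^] n"
    using x y by (subst nat_pow_Suc, subst m_comm) (auto simp: l_distr)
  also have "\<dots> = (\<Oplus>k\<in>{..n}. [(n choose k)] \<cdot> ?m (Suc k) (n - k)) \<oplus>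
      (\<Oplus>k\<in>{..Suc n}. [(n choose k)] \<cdot> ?m k (Suc n - k))"
    by (simp only: Suc.IH X Y)
  also have "\<dots> = (\<Oplus>k\<in>{..n}. [(n choose k)] \<cdot> ?m (Suc k) (n - k)) \<oplus>
     ((\<Oplus>k\<in>{..n}. [(n choose Suc k)] \<cdot> ?m (Suc k) (n - k)) \<oplus> ?m 0 (Suc n))"
    using x y by (subst finsum_Suc2) auto
  also have "\<dots> = (\<Oplus>k\<in>{..n}. [(Suc n choose Suc k)] \<cdot> ?m (Suc k) (n - k)) \<oplus> ?m 0 (Suc n)"
    using x y by (subst a_assoc[symmetric])
      (auto intro!: finsum_closed arg_cong2[where f = "(\<oplus>)"] finsum_cong'
        simp: finsum_addf[symmetric] add.nat_pow_mult)
  also have "\<dots> = (\<Oplus>k\<in>{..Suc n}. [(Suc n choose k)] \<cdot> ?m k (Suc n - k))"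
    using x y by (subst finsum_Suc2) auto
  finally show ?case .
qed

lemma (in cring) add_pow_multiple_char:
  assumes "[(p::nat)] \<cdot> \<one> = \<zero>" "p dvd n" "x \<in> carrier R"
  shows "[n] \<cdot> x = \<zero>"
proof -
  obtain m where n: "n = p * m" using assms(2) by blast
  have "[p] \<cdot> x = ([p] \<cdot> \<one>) \<otimes> x" using assms(3) by (simp add: add_pow_ldistr)
  hence "[p] \<cdot> x = \<zero>" using assms by simp
  thus ?thesis using assms(3) by (simp add: n add.nat_pow_pow[symmetric])
qed

lemma (in cring) frobenius_add:
  assumes p: "prime (p::nat)" and char: "[p] \<cdot> \<one> = \<zero>"
    and x: "x \<in> carrier R" and y: "y \<in> carrier R"
  shows "(x \<oplus> y) [^] p = x [^] p \<oplus> y [^] p"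
proof -
  have p0: "p > 0" using p prime_gt_0_nat by blast
  then obtain r where r: "p = Suc r" using gr0_implies_Suc by blast
  let ?t = "\<lambda>k. [(p choose k)] \<cdot> (x [^] k \<otimes> y [^] (p - k))"
  have mid: "?t k = \<zero>" if "0 < k" "k < p" for k
    using that x y
    by (intro add_pow_multiple_char[OF char]) (auto intro!: dvd_choose_prime p)
  have c: "?t k \<in> carrier R" for k using x y by simp
  have "(x \<oplus> y) [^] p = (\<Oplus>k\<in>{..p}. ?t k)"
    using x y by (rule binomial_expansion)
  also have "\<dots> = (\<Oplus>k\<in>{0, p}. ?t k)"
    using mid c by (intro add.finprod_mono_neutral_cong_right) auto
  also have "\<dots> = ?t 0 \<oplus> ?t p"
    using p0 c x y by (subst finsum_insert) auto
  also have "\<dots> = x [^] p \<oplus> y [^] p"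
    using x y by (simp add: add.nat_pow_eone a_comm)
  finally show ?thesis .
qed

lemma (in cring) frobenius_pow_add:
  assumes p: "prime (p::nat)" and char: "[p] \<cdot> \<one> = \<zero>"
    and x: "x \<in> carrier R" and y: "y \<in> carrier R"
  shows "(x \<oplus> y) [^] (p ^ i) = x [^] (p ^ i) \<oplus> y [^] (p ^ i)"
proof (induction i)
  case (Suc i)
  have "(x \<oplus> y) [^] (p ^ Suc i) = ((x \<oplus> y) [^] (p ^ i)) [^] p"
    using x y by (simp add: nat_pow_pow mult.commute[of p])
  also have "\<dots> = (x [^] (p ^ i)) [^] p \<oplus> (y [^] (p ^ i)) [^] p"
    using x y by (simp add: Suc frobenius_add[OF p char])
  finally show ?case using x y by (simp add: nat_pow_pow mult.commute[of p])
qed (use x y in simp)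

text \<open>Lagrange's theorem in the additive group kills \<open>p ^ N\<close> times
  \<open>\<one>\<close>. This element is the \<open>N\<close>-th power of
  \<open>[p] \<cdot> \<one>\<close>, and a domain has no nonzero nilpotent elements.\<close>

lemma (in domain) char_of_prime_power_card:
  assumes p: "prime (p::nat)" and card: "card (carrier R) = p ^ N"
  shows "[p] \<cdot> \<one> = \<zero>"
proof -
  have "\<one> [^]\<^bsub>add_monoid R\<^esub> order (add_monoid R) = \<one>\<^bsub>add_monoid R\<^esub>"
    by (rule group.pow_order_eq_1[OF a_group]) simp
  hence *: "[(p ^ N)] \<cdot> \<one> = \<zero>"
    by (simp add: order_def card add_pow_def)
  have "([p] \<cdot> \<one>) [^] M = [(p ^ M)] \<cdot> \<one>" for M
    by (induction M) (simp_all add: add.nat_pow_eone add_pow_rdistr add.nat_pow_pow mult.commute)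
  with * have "([p] \<cdot> \<one>) [^] N = \<zero>" by simp
  moreover have "([p] \<cdot> \<one>) [^] M \<noteq> \<zero>" if "[p] \<cdot> \<one> \<noteq> \<zero>" for M :: nat
  proof (induction M)
    case (Suc M)
    thus ?case using that integral[of "([p] \<cdot> \<one>) [^] M" "[p] \<cdot> \<one>"] by auto
  qed simp
  ultimately show ?thesis by blast
qed

lemma (in cring) add_pow_one_cong:
  assumes char: "[(p::nat)] \<cdot> \<one> = \<zero>"
  shows "[(n mod p)] \<cdot> \<one> = [n] \<cdot> \<one>"
proof -
  have "[n] \<cdot> \<one> = [(p * (n div p) + n mod p)] \<cdot> \<one>" by simp
  also have "\<dots> = [(p * (n div p))] \<cdot> \<one> \<oplus> [(n mod p)] \<cdot> \<one>"
    by (subst add.nat_pow_mult) auto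
  also have "\<dots> = [(n mod p)] \<cdot> \<one>"
    by (subst add_pow_multiple_char[OF char]) auto
  finally show ?thesis by simp
qed

text \<open>The prime field is a copy of the integers mod \<open>p\<close>; this makes the additive
  character \<open>psi 0\<close> well defined. If \<open>k\<close> were prime to \<open>p\<close>
  and killed \<open>\<one>\<close>, an inverse \<open>u\<close> of \<open>k\<close> mod
  \<open>p\<close> would give \<open>\<one> = \<zero>\<close>.\<close>

lemma (in domain) add_pow_one_eq_iff:
  assumes p: "prime (p::nat)" and char: "[p] \<cdot> \<one> = \<zero>"
  shows "[m] \<cdot> \<one> = [(n::nat)] \<cdot> \<one> \<longleftrightarrow> m mod p = n mod p"
proof
  have 0: "p dvd k" if "[(k::nat)] \<cdot> \<one> = \<zero>" for k
  proof (rule ccontr)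
    assume "\<not> p dvd k"
    hence "coprime k p" using p by (metis prime_imp_coprime coprime_commute)
    then obtain u where "[k * u = Suc 0] (mod p)" using cong_solve_coprime_nat by blast
    hence u: "k * u mod p = 1 mod p" by (simp add: cong_def)
    have "\<one> = [(1::nat)] \<cdot> \<one>" by (simp add: add.nat_pow_eone)
    also have "\<dots> = [(k * u)] \<cdot> \<one>"
      using u add_pow_one_cong[OF char] by metis
    also have "\<dots> = \<zero>" using add_pow_multiple_char[OF that] by simp
    finally show False by simp
  qed
  have aux: "m mod p = n mod p" if "m \<le> n" "[m] \<cdot> \<one> = [n] \<cdot> \<one>" for m n :: nat
  proof -
    have "[n] \<cdot> \<one> = [m] \<cdot> \<one> \<oplus> [(n - m)] \<cdot> \<one>"
      using \<open>m \<le> n\<close> by (subst add.nat_pow_mult) auto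
    hence "[m] \<cdot> \<one> \<oplus> [(n - m)] \<cdot> \<one> = [m] \<cdot> \<one>" using that(2) by simp
    hence "[(n - m)] \<cdot> \<one> = \<zero>" by (subst (asm) add.l_cancel_one) auto
    hence "p dvd n - m" by (rule 0)
    thus ?thesis by (rule mod_eq_dvd_iff_nat[OF \<open>m \<le> n\<close>, THEN iffD2, symmetric])
  qed
  show "m mod p = n mod p" if "[m] \<cdot> \<one> = [n] \<cdot> \<one>"
  proof (cases "m \<le> n")
    case True
    thus ?thesis using that by (rule aux)
  next
    case False
    thus ?thesis using aux[of n m, OF _ that[symmetric]] by linarith
  qed
  show "[m] \<cdot> \<one> = [n] \<cdot> \<one>" if "m mod p = n mod p"
    using add_pow_one_cong[OF char, of m] add_pow_one_cong[OF char, of n] that by simp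
qed

section \<open>Gauss sums over a quadratic extension\<close>

lemma sum_over_fibers:
  fixes h :: "'b \<Rightarrow> complex"
  assumes "finite S" "finite T" "g ` S \<subseteq> T"
  shows "(\<Sum>x\<in>S. h (g x)) = (\<Sum>t\<in>T. of_nat (card {x \<in> S. g x = t}) * h t)"
proof -
  have "(\<Sum>x\<in>S. h (g x)) = (\<Sum>t\<in>T. \<Sum>x\<in>{x \<in> S. g x = t}. h (g x))"
    by (rule sum.group[symmetric]) (use assms in auto)
  also have "\<dots> = (\<Sum>t\<in>T. of_nat (card {x \<in> S. g x = t}) * h t)"
    by (rule sum.cong) auto
  finally show ?thesis .
qed

locale prime_power_field = field R for R (structure) +
  fixes p N :: nat
  assumes prime_p: "prime p" and card_carrier: "card (carrier R) = p ^ N"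
begin

text \<open>For $d$ a power of \<open>p\<close> with $d - 1$ dividing $p^N - 1$ this is the subfield of order \<open>d\<close>.\<close>

definition fixed :: "nat \<Rightarrow> 'a set" where
  "fixed d = {x \<in> carrier R. x [^] d = x}"

text \<open>A primitive element, chosen once: membership in a subfield, being a fourth power and the
  quartic character all become conditions on its exponent.\<close>

definition gen :: 'a where
  "gen = (SOME g. g \<in> carrier R - {\<zero>} \<and> carrier R - {\<zero>} = {g [^] i | i :: nat. True})"

section \<open>The primitive element and the subfields\<close>

lemma finite_carrier: "finite (carrier R)"
  using card_carrier prime_p by (metis card.infinite power_not_zero not_prime_0)

lemma char_p: "[p] \<cdot> \<one> = \<zero>"
  using char_of_prime_power_card[OF prime_p card_carrier] .

lemma gen_closed: "gen \<in> carrier R" and gen_nonzero: "gen \<noteq> \<zero>"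
  and nonzero_eq_gen_pow: "carrier R - {\<zero>} = {gen [^] i | i :: nat. True}"
proof -
  have "\<exists>g. g \<in> carrier R - {\<zero>} \<and> carrier R - {\<zero>} = {g [^] i | i :: nat. True}"
    using finite_field_mult_group_has_gen[OF finite_carrier]
    by (auto simp: nat_pow_mult_of Bex_def)
  from someI_ex[OF this]
  show "gen \<in> carrier R" "gen \<noteq> \<zero>" "carrier R - {\<zero>} = {gen [^] i | i :: nat. True}"
    unfolding gen_def[symmetric] by auto
qed

lemma card_carrier_gt_1: "p ^ N > 1"
proof -
  have "card {\<zero>, \<one>} \<le> card (carrier R)"
    by (rule card_mono) (auto simp: finite_carrier)
  thus ?thesis using card_carrier by simp
qed

lemma gen_pow_eq_iff: "gen [^] i = gen [^] (k::nat) \<longleftrightarrow> [i = k] (mod (p ^ N - 1))"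
proof -
  interpret M: group "mult_of R" by (rule field_mult_group)
  have g: "gen \<in> carrier (mult_of R)" using gen_closed gen_nonzero by simp
  have "generate (mult_of R) {gen} = carrier (mult_of R)"
    using M.generate_pow_on_finite_carrier[OF finite_mult_of[OF finite_carrier] g]
      nonzero_eq_gen_pow by (simp add: nat_pow_mult_of)
  hence ord: "M.ord gen = p ^ N - 1"
    using M.generate_pow_card[OF g] order_mult_of[OF finite_carrier]
    unfolding order_def card_carrier by simp
  have aux: "gen [^] i = gen [^] k \<longleftrightarrow> p ^ N - 1 dvd k - i" if "i \<le> k" for i k :: nat
  proof -
    have "gen [^] k = gen [^] i \<otimes> gen [^] (k - i)"
      using that gen_closed by (simp add: nat_pow_mult)
    hence "gen [^] i = gen [^] k \<longleftrightarrow> gen [^] (k - i) = \<one>"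
      using M.l_cancel_one'[of "gen [^] i" "gen [^] (k - i)"] M.nat_pow_closed[OF g, of i]
        M.nat_pow_closed[OF g, of "k - i"] unfolding nat_pow_mult_of one_mult_of mult_mult_of by simp
    also have "\<dots> \<longleftrightarrow> p ^ N - 1 dvd k - i"
      using M.pow_eq_id[OF g, of "k - i"] by (simp add: ord nat_pow_mult_of)
    finally show ?thesis .
  qed
  show ?thesis
  proof (cases "i \<le> k")
    case True
    show ?thesis
      unfolding aux[OF True] mod_eq_dvd_iff_nat[OF True, symmetric] cong_def by (rule eq_commute)
  next
    case False
    hence *: "k \<le> i" by simp
    show ?thesis
      unfolding cong_def mod_eq_dvd_iff_nat[OF *] aux[OF *, symmetric] by (rule eq_commute)
  qed
qed

lemma gen_pow_nonzero: "gen [^] (i::nat) \<noteq> \<zero>"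
  using nonzero_eq_gen_pow by blast

lemma nonzero_cases:
  assumes "x \<in> carrier R" "x \<noteq> \<zero>"
  obtains i :: nat where "x = gen [^] i"
  using assms nonzero_eq_gen_pow by blast

lemma pow_card: "x \<in> carrier R \<Longrightarrow> x [^] (p ^ N) = x"
proof (cases "x = \<zero>")
  case False
  assume "x \<in> carrier R"
  with False obtain i :: nat where i: "x = gen [^] i" using nonzero_cases by blast
  have "[i * p ^ N = i * 1] (mod (p ^ N - 1))"
    using card_carrier_gt_1 mod_eq_dvd_iff_nat[of 1 "p ^ N" "p ^ N - 1"]
    by (intro cong_mult) (auto simp: cong_def)
  thus ?thesis using gen_closed by (simp add: i nat_pow_pow gen_pow_eq_iff)
next
  case True
  thus ?thesis using card_carrier_gt_1 nat_pow_zero[of "p ^ N"] by (metis not_one_less_zero)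
qed

text \<open>Being fixed means \<open>i * d = i\<close> modulo \<open>(d - 1) * m\<close>, and the
  factor \<open>d - 1\<close> cancels from the resulting divisibility.\<close>

lemma gen_pow_in_fixed_iff:
  assumes d: "d \<ge> 2" and dvd: "d - 1 dvd p ^ N - 1"
  shows "gen [^] (i::nat) \<in> fixed d \<longleftrightarrow> (p ^ N - 1) div (d - 1) dvd i"
proof -
  obtain m where m: "p ^ N - 1 = (d - 1) * m" using dvd by blast
  have "gen [^] i \<in> fixed d \<longleftrightarrow> [i * d = i] (mod (p ^ N - 1))"
    using gen_closed by (simp add: fixed_def nat_pow_pow gen_pow_eq_iff)
  also have "\<dots> \<longleftrightarrow> (d - 1) * m dvd i * d - i"
    unfolding m[symmetric] cong_def using d by (subst mod_eq_dvd_iff_nat) auto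
  also have "i * d - i = (d - 1) * i" by (simp add: algebra_simps)
  finally show ?thesis using d m by simp
qed

text \<open>Besides \<open>\<zero>\<close>, the fixed elements are the powers of
  \<open>gen [^] m\<close>, where \<open>m\<close> is the quotient of the two group orders; there
  are \<open>d - 1\<close> of them.\<close>

lemma card_fixed:
  assumes d: "d \<ge> 2" and dvd: "d - 1 dvd p ^ N - 1"
  shows "card (fixed d) = d"
proof -
  define m where "m = (p ^ N - 1) div (d - 1)"
  have m: "p ^ N - 1 = (d - 1) * m" unfolding m_def using dvd by simp
  have m0: "m > 0" using m card_carrier_gt_1 by (cases m) auto
  have "fixed d = insert \<zero> ((\<lambda>i. gen [^] (i * m)) ` {..<d - 1})"
  proof (rule Set.set_eqI, rule iffI)
    fix x assume x: "x \<in> fixed d"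
    show "x \<in> insert \<zero> ((\<lambda>i. gen [^] (i * m)) ` {..<d - 1})"
    proof (cases "x = \<zero>")
      case False
      then obtain i :: nat where i: "x = gen [^] i" using x nonzero_cases unfolding fixed_def by blast
      then obtain j where j: "i = m * j"
        using x gen_pow_in_fixed_iff[OF d dvd] unfolding m_def[symmetric] by blast
      have "[j mod (d - 1) * m = i] (mod (p ^ N - 1))"
        unfolding j m cong_def mult.commute[of m j] by (simp only: mod_mult_mult2 mod_mod_trivial)
      hence "x = gen [^] (j mod (d - 1) * m)" by (simp add: i gen_pow_eq_iff cong_sym)
      moreover have "j mod (d - 1) < d - 1" using d by simp
      ultimately show ?thesis by blast
    qed simp
  next
    fix x assume "x \<in> insert \<zero> ((\<lambda>i. gen [^] (i * m)) ` {..<d - 1})"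
    thus "x \<in> fixed d"
    proof
      assume "x = \<zero>"
      thus ?thesis using d by (simp add: fixed_def nat_pow_zero)
    next
      assume "x \<in> (\<lambda>i. gen [^] (i * m)) ` {..<d - 1}"
      then obtain i :: nat where "x = gen [^] (i * m)" by blast
      moreover have "gen [^] (i * m) \<in> fixed d"
        by (subst gen_pow_in_fixed_iff[OF d dvd]) (simp add: m_def)
      ultimately show ?thesis by simp
    qed
  qed
  moreover have "inj_on (\<lambda>i. gen [^] (i * m)) {..<d - 1}"
  proof (rule inj_onI)
    fix i j assume ij: "i \<in> {..<d - 1}" "j \<in> {..<d - 1}" "gen [^] (i * m) = gen [^] (j * m)"
    have "[i * m = j * m] (mod (d - 1) * m)"
      using ij(3) unfolding gen_pow_eq_iff m .
    hence "i mod (d - 1) = j mod (d - 1)"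
      unfolding cong_def mod_mult_mult2 using m0 by simp
    thus "i = j" using ij by simp
  qed
  ultimately show ?thesis
    using d gen_pow_nonzero by (simp add: card_insert_if card_image) fastforce
qed

lemma fixed_closed: "x \<in> fixed d \<Longrightarrow> x \<in> carrier R"
  by (simp add: fixed_def)

lemma finite_fixed: "finite (fixed d)"
  using finite_carrier by (simp add: fixed_def)

lemma fixed_mult: "x \<in> fixed d \<Longrightarrow> y \<in> fixed d \<Longrightarrow> x \<otimes> y \<in> fixed d"
  by (simp add: fixed_def nat_pow_distrib)

lemma fixed_one: "\<one> \<in> fixed d"
  by (simp add: fixed_def)

lemma fixed_zero: "d > 0 \<Longrightarrow> \<zero> \<in> fixed d"
  by (simp add: fixed_def nat_pow_zero)

lemma frobenius:
  "x \<in> carrier R \<Longrightarrow> y \<in> carrier R \<Longrightarrow> (x \<oplus> y) [^] (p ^ i) = x [^] (p ^ i) \<oplus> y [^] (p ^ i)"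
  by (rule frobenius_pow_add[OF prime_p char_p])

lemma fixed_add: "x \<in> fixed (p ^ i) \<Longrightarrow> y \<in> fixed (p ^ i) \<Longrightarrow> x \<oplus> y \<in> fixed (p ^ i)"
  by (simp add: fixed_def frobenius)

lemma fixed_uminus: 
  assumes "x \<in> fixed (p ^ i)"
  shows "\<ominus> x \<in> fixed (p ^ i)"
proof -
  have x: "x \<in> carrier R" "x [^] (p ^ i) = x" using assms by (auto simp: fixed_def)
  have "(x \<oplus> \<ominus> x) [^] (p ^ i) = \<zero>"
    using x prime_p by (simp add: r_neg nat_pow_zero)
  hence "x \<oplus> (\<ominus> x) [^] (p ^ i) = \<zero>" using x by (simp only: frobenius a_inv_closed)
  hence "(\<ominus> x) [^] (p ^ i) = \<ominus> x"
    using x by (metis a_inv_closed minus_equality nat_pow_closed a_comm)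
  thus ?thesis using x by (simp add: fixed_def)
qed

lemma fixed_minus: "x \<in> fixed (p ^ i) \<Longrightarrow> y \<in> fixed (p ^ i) \<Longrightarrow> x \<ominus> y \<in> fixed (p ^ i)"
  by (simp add: minus_eq fixed_add fixed_uminus)

text \<open>These are the relative trace and norm of the quadratic extension: the Frobenius map
  swaps the two conjugates.\<close>

lemma trace_norm_in_fixed:
  assumes "x \<in> fixed ((p ^ i)\<^sup>2)"
  shows "x \<oplus> x [^] (p ^ i) \<in> fixed (p ^ i)" "x \<otimes> x [^] (p ^ i) \<in> fixed (p ^ i)"
proof -
  have x: "x \<in> carrier R" "(x [^] (p ^ i)) [^] (p ^ i) = x"
    using assms by (auto simp: fixed_def nat_pow_pow power2_eq_square)
  show "x \<oplus> x [^] (p ^ i) \<in> fixed (p ^ i)"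
    using x by (simp add: fixed_def frobenius a_comm)
  show "x \<otimes> x [^] (p ^ i) \<in> fixed (p ^ i)"
    using x by (simp add: fixed_def nat_pow_distrib m_comm)
qed

lemma quadratic_roots:
  assumes "t \<in> carrier R" "z \<in> carrier R" "x \<in> carrier R"
    "x \<otimes> (t \<ominus> x) = z \<otimes> (t \<ominus> z)"
  shows "x = z \<or> x = t \<ominus> z"
proof -
  have "(x \<ominus> z) \<otimes> (t \<ominus> z \<ominus> x) = x \<otimes> (t \<ominus> x) \<ominus> z \<otimes> (t \<ominus> z)"
    using assms(1-3) by algebra
  hence "(x \<ominus> z) \<otimes> (t \<ominus> z \<ominus> x) = \<zero>"
    using assms by (simp add: r_right_minus_eq)
  hence "x \<ominus> z = \<zero> \<or> t \<ominus> z \<ominus> x = \<zero>" using assms by (intro integral) auto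
  thus ?thesis using assms by (auto simp: r_right_minus_eq)
qed

text \<open>
  Both sets consist of roots of \<open>X\<^sup>2 - t X + n\<close>: the first of roots with \<open>x\<^sup>q = t - x\<close>, the second (by
  its first components) of roots with \<open>x\<^sup>q = x\<close>. A root in both is a double root.
\<close>

lemma conjugates_le_2:
  assumes t: "t \<in> carrier R"
  shows "card {x \<in> fixed ((p ^ i)\<^sup>2). (x \<oplus> x [^] (p ^ i), x \<otimes> x [^] (p ^ i)) = (t, n)} +
    card {z \<in> fixed (p ^ i) \<times> fixed (p ^ i). (fst z \<oplus> snd z, fst z \<otimes> snd z) = (t, n)} \<le> 2"
    (is "card ?A + card ?B \<le> 2")
proof -
  define Z where "Z = {x \<in> carrier R. x \<otimes> (t \<ominus> x) = n}"
  have finA: "finite ?A" by (simp add: finite_fixed)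
  have B': "snd z = t \<ominus> fst z" if "z \<in> ?B" for z
  proof -
    have c: "fst z \<in> carrier R" "snd z \<in> carrier R" "fst z \<oplus> snd z = t"
      using that fixed_closed by auto
    show ?thesis unfolding c(3)[symmetric] using c(1,2) by algebra
  qed
  have inj: "inj_on fst ?B"
  proof (rule inj_onI)
    fix z w assume "z \<in> ?B" "w \<in> ?B" "fst z = fst w"
    thus "z = w" using B'[of z] B'[of w] by (simp only: prod_eq_iff)
  qed
  hence cB: "card ?B = card (fst ` ?B)" by (simp add: card_image)
  have finB: "finite (fst ` ?B)" by (simp add: finite_fixed)
  have A: "x \<in> Z \<and> x [^] (p ^ i) = t \<ominus> x" if "x \<in> ?A" for x
  proof -
    have x: "x \<in> carrier R" and *: "t = x \<oplus> x [^] (p ^ i)" "x \<otimes> x [^] (p ^ i) = n" 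
      using that fixed_closed by auto
    have "x [^] (p ^ i) = t \<ominus> x"
      unfolding * using x nat_pow_closed[OF x, of "p ^ i"] by algebra
    thus ?thesis using x * by (auto simp: Z_def)
  qed
  have B: "x \<in> Z \<and> x [^] (p ^ i) = x" if "x \<in> fst ` ?B" for x
  proof -
    from that obtain z where z: "z \<in> ?B" "x = fst z" by blast
    hence "x \<in> fixed (p ^ i)" "x \<otimes> snd z = n" by auto
    moreover have "snd z = t \<ominus> x" using B'[OF z(1)] z(2) by simp
    ultimately show ?thesis by (auto simp: Z_def fixed_def)
  qed
  show ?thesis
  proof (cases "Z = {}")
    case True
    hence "?A = {}" "fst ` ?B = {}" using A B by blast+
    thus ?thesis by (simp only: cB card.empty)
  next
    case False
    then obtain z where z: "z \<in> Z" by blast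
    hence zc: "z \<in> carrier R" "t \<ominus> z \<in> carrier R" using t by (auto simp: Z_def)
    have Z: "x = z \<or> x = t \<ominus> z" if "x \<in> Z" for x
      using that z t quadratic_roots[of t z x] by (auto simp: Z_def)
    show ?thesis
    \<comment> \<open>With a double root the sets may overlap, but each then has at most one
      element. With distinct roots they are disjoint and lie in a set of two elements.\<close>
    proof (cases "z = t \<ominus> z")
      case True
      hence "Z \<subseteq> {z}" using Z by auto
      hence "?A \<subseteq> {z}" "fst ` ?B \<subseteq> {z}" using A B by blast+
      hence "card ?A \<le> 1" "card (fst ` ?B) \<le> 1"
        using card_mono[of "{z}"] by fastforce+
      thus ?thesis unfolding cB by simp
    next
      case False
      have dis: "?A \<inter> fst ` ?B = {}"
      proof (rule ccontr)
        assume "?A \<inter> fst ` ?B \<noteq> {}"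
        then obtain x where xA: "x \<in> ?A" and xB: "x \<in> fst ` ?B" by blast
        have x: "x = t \<ominus> x"
          using conjunct2[OF B[OF xB], symmetric] conjunct2[OF A[OF xA]] by (rule trans)
        have xZ: "x \<in> Z" using A[OF xA] by (rule conjunct1)
        have "t \<ominus> (t \<ominus> z) = z" using zc(1) t by algebra
        thus False using x Z[OF xZ] False by metis
      qed
      have "?A \<union> fst ` ?B \<subseteq> {z, t \<ominus> z}" using A B Z by blast
      hence "card (?A \<union> fst ` ?B) \<le> card {z, t \<ominus> z}" by (intro card_mono) auto
      also have "\<dots> \<le> 2" by (simp add: card_insert_if)
      finally show ?thesis unfolding cB
        using card_Un_disjoint[OF finA finB dis] by simp
    qed
  qed
qed

text \<open>
  The Hasse--Davenport relation in degree two. Summed over the \<open>q\<^sup>2\<close> pairs \<open>(t, n)\<close>, the two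
  cardinalities bounded in \<open>conjugates_le_2\<close> give \<open>q\<^sup>2 + q\<^sup>2\<close>, so they always add up to exactly 2, and
  the sum of the two sides is twice a product of two character sums, one of which vanishes.
\<close>

lemma gauss_sum_quadratic_extension:
  fixes \<chi> \<psi> :: "'a \<Rightarrow> complex"
  assumes q: "q = p ^ i" "i > 0" and dvd: "q\<^sup>2 - 1 dvd p ^ N - 1"
    and mult: "\<And>x y. x \<in> fixed q \<Longrightarrow> y \<in> fixed q \<Longrightarrow> \<chi> (x \<otimes> y) = \<chi> x * \<chi> y"
    and add: "\<And>x y. x \<in> fixed q \<Longrightarrow> y \<in> fixed q \<Longrightarrow> \<psi> (x \<oplus> y) = \<psi> x * \<psi> y"
    and sum0: "(\<Sum>x\<in>fixed q. \<chi> x) = 0"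
  shows "(\<Sum>x\<in>fixed (q\<^sup>2). \<chi> (x \<otimes> x [^] q) * \<psi> (x \<oplus> x [^] q)) =
    - (\<Sum>x\<in>fixed q. \<chi> x * \<psi> x)\<^sup>2"
proof -
  let ?F = "fixed q" and ?K = "fixed (q\<^sup>2)"
  define h where "h = (\<lambda>z. \<chi> (snd z) * \<psi> (fst z))"
  define f where "f = (\<lambda>x. (x \<oplus> x [^] q, x \<otimes> x [^] q))"
  define g where "g = (\<lambda>z. (fst z \<oplus> snd z, fst z \<otimes> snd z))"
  let ?A = "\<lambda>z. {x \<in> ?K. f x = z}" and ?B = "\<lambda>z. {x \<in> ?F \<times> ?F. g x = z}"
  have q2: "q \<ge> 2" 
    using self_le_power[of p i] prime_ge_2_nat[OF prime_p] q by simp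
  have qq: "q\<^sup>2 \<ge> 2" using q2 le_square[of q] unfolding power2_eq_square by linarith
  have "q - 1 dvd q\<^sup>2 - 1" 
    by (rule dvdI[of _ _ "q + 1"]) (cases q, simp_all add: power2_eq_square)
  hence "q - 1 dvd p ^ N - 1" using dvd dvd_trans by blast
  hence cF: "card ?F = q" using q2 by (intro card_fixed)
  have cK: "card ?K = q\<^sup>2" using qq dvd by (intro card_fixed)
  have imf: "f ` ?K \<subseteq> ?F \<times> ?F"
    using trace_norm_in_fixed unfolding f_def q by auto
  have img: "g ` (?F \<times> ?F) \<subseteq> ?F \<times> ?F"
    by (auto simp: g_def q fixed_add fixed_mult)
  have le2: "card (?A z) + card (?B z) \<le> 2" if z: "z \<in> ?F \<times> ?F" for z
    using conjugates_le_2[of "fst z" i "snd z"] z fixed_closed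
    unfolding f_def g_def q by auto
  have count: "card S = (\<Sum>z\<in>?F \<times> ?F. card {x \<in> S. f x = z})"
    if "finite S" "f ` S \<subseteq> ?F \<times> ?F" for S and f :: "'x \<Rightarrow> _"
    using sum.group[of S "?F \<times> ?F" f "\<lambda>_. 1::nat"] that by (simp add: finite_fixed)
  have "(\<Sum>z\<in>?F \<times> ?F. card (?A z) + card (?B z)) = q\<^sup>2 + q\<^sup>2"
    unfolding sum.distrib
  proof (rule arg_cong2[where f = "(+)"])
    show "(\<Sum>z\<in>?F \<times> ?F. card (?A z)) = q\<^sup>2"
      using count[OF finite_fixed imf] cK by simp
    show "(\<Sum>z\<in>?F \<times> ?F. card (?B z)) = q\<^sup>2"
      using count[OF _ img] by (simp add: finite_fixed cF card_cartesian_product power2_eq_square)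
  qed
  also have "\<dots> = (\<Sum>z\<in>?F \<times> ?F. 2)"
    by (simp add: cF card_cartesian_product power2_eq_square)
  finally have eq2: "card (?A z) + card (?B z) = 2" if "z \<in> ?F \<times> ?F" for z
    using sum_mono_inv[of "\<lambda>z. card (?A z) + card (?B z)" "?F \<times> ?F" "\<lambda>_. 2" z] le2 that
    by (auto simp: finite_fixed)
  have "(\<Sum>x\<in>?K. h (f x)) + (\<Sum>z\<in>?F \<times> ?F. h (g z)) =
     (\<Sum>z\<in>?F \<times> ?F. of_nat (card (?A z)) * h z) + (\<Sum>z\<in>?F \<times> ?F. of_nat (card (?B z)) * h z)"
    using imf img by (intro arg_cong2[where f = "(+)"] sum_over_fibers) (auto simp: finite_fixed)
  also have "\<dots> = (\<Sum>z\<in>?F \<times> ?F. of_nat (card (?A z) + card (?B z)) * h z)"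
    by (simp add: sum.distrib algebra_simps)
  also have "\<dots> = (\<Sum>z\<in>?F \<times> ?F. 2 * h z)"
    by (intro sum.cong refl) (simp only: eq2, simp)
  also have "\<dots> = 2 * (\<Sum>t\<in>?F. \<Sum>n\<in>?F. \<chi> n * \<psi> t)"
    by (simp add: h_def sum.cartesian_product sum_distrib_left case_prod_unfold)
  also have "\<dots> = 0"
    by (simp add: sum_distrib_right[symmetric] sum0)
  finally have "(\<Sum>x\<in>?K. h (f x)) = - (\<Sum>z\<in>?F \<times> ?F. h (g z))"
    by (simp add: add_eq_0_iff)
  also have "(\<Sum>z\<in>?F \<times> ?F. h (g z)) = (\<Sum>z\<in>?F \<times> ?F. (\<chi> (fst z) * \<psi> (fst z)) * (\<chi> (snd z) * \<psi> (snd z)))"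
    by (intro sum.cong refl) (auto simp: h_def g_def mult add)
  also have "\<dots> = (\<Sum>x\<in>?F. \<chi> x * \<psi> x)\<^sup>2"
    by (simp add: power2_eq_square sum_product sum.cartesian_product case_prod_unfold)
  finally show ?thesis by (simp add: h_def f_def)
qed

end

section \<open>Quartic characters in a tower of quadratic extensions\<close>

lemma i_power_4: "\<i> ^ (4 * n) = (1 :: complex)"
  by (simp add: power_mult)

lemma i_power_mod: "\<i> ^ (n mod 4) = (\<i> ^ n :: complex)"
proof -
  have "(\<i> :: complex) ^ n = \<i> ^ (4 * (n div 4) + n mod 4)" by simp
  also have "\<dots> = \<i> ^ (n mod 4)" unfolding power_add i_power_4 by simp
  finally show ?thesis by simp
qed

definition gaussian_ints :: "complex set" where
  "gaussian_ints = {Complex (of_int a) (of_int b) | a b. True}"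

lemma gaussian_ints_iff: "z \<in> gaussian_ints \<longleftrightarrow> Re z \<in> \<int> \<and> Im z \<in> \<int>"
  unfolding gaussian_ints_def Ints_def by (auto simp: complex_eq_iff)

lemma gaussian_ints_add: "x \<in> gaussian_ints \<Longrightarrow> y \<in> gaussian_ints \<Longrightarrow> x + y \<in> gaussian_ints"
  by (simp add: gaussian_ints_iff)

lemma gaussian_ints_mult: "x \<in> gaussian_ints \<Longrightarrow> y \<in> gaussian_ints \<Longrightarrow> x * y \<in> gaussian_ints"
  by (simp add: gaussian_ints_iff)

lemma gaussian_ints_0: "0 \<in> gaussian_ints" and gaussian_ints_1: "1 \<in> gaussian_ints"
  and gaussian_ints_i: "\<i> \<in> gaussian_ints"
  by (simp_all add: gaussian_ints_iff)

lemma gaussian_ints_power: "x \<in> gaussian_ints \<Longrightarrow> x ^ n \<in> gaussian_ints"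
  by (induction n) (auto intro: gaussian_ints_1 gaussian_ints_mult)

lemma gaussian_ints_sum: "(\<And>x. x \<in> A \<Longrightarrow> f x \<in> gaussian_ints) \<Longrightarrow> sum f A \<in> gaussian_ints"
  by (induction A rule: infinite_finite_induct) (auto intro: gaussian_ints_0 gaussian_ints_add)

locale quartic_tower = prime_power_field R p "2 ^ J" for R (structure) and p J :: nat +
  assumes p_mod_4: "p mod 4 = 1"
begin

text \<open>The orders of the fields in the tower: level 0 is the prime field and level
  \<open>J\<close> the whole field.\<close>

definition q :: "nat \<Rightarrow> nat" where "q j = p ^ (2 ^ j)"

abbreviation F :: "nat \<Rightarrow> 'a set" where "F j \<equiv> fixed (q j)"

definition omega :: 'a where "omega = gen [^] ((q J - 1) div 4)"

text \<open>
  The isomorphism from the fourth roots of unity of the field to those of the complex numbers,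
  with value 0 elsewhere; the choice of the exponent is immaterial because it is determined mod 4.
\<close>

definition quartic :: "'a \<Rightarrow> complex" where
  "quartic x = (if \<exists>i::nat. x = omega [^] i then \<i> ^ (SOME i. x = omega [^] i) else 0)"

text \<open>The quartic residue character of level \<open>j\<close>. All levels use the same
  \<open>omega\<close>, which makes the characters compatible with the norm in
  \<open>chi_Suc\<close>.\<close>

definition chi :: "nat \<Rightarrow> 'a \<Rightarrow> complex" where
  "chi j x = quartic (x [^] ((q j - 1) div 4))"

text \<open>
  On the prime field the exponent \<open>k\<close> is determined mod \<open>p\<close>. The value of \<open>psi j\<close> is meaningful on
  \<open>F j\<close> only; there it is \<open>psi 0\<close> composed with the trace, just as \<open>chi j\<close> is \<open>chi 0\<close> composed with the
  norm.
\<close>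

primrec psi :: "nat \<Rightarrow> 'a \<Rightarrow> complex" where
  "psi 0 x = cis (2 * pi * real (SOME k. x = [(k::nat)] \<cdot> \<one>) / real p)"
| "psi (Suc j) x = psi j (x \<oplus> x [^] q j)"

definition gauss :: "nat \<Rightarrow> nat \<Rightarrow> complex" where
  "gauss j m = (\<Sum>x\<in>F j. chi j x ^ m * psi j x)"

lemma q_Suc: "q (Suc j) = (q j)\<^sup>2"
  by (simp add: q_def power_mult[symmetric] mult.commute)

lemma q_mod_4: "q j mod 4 = 1"
proof (induction j)
  case (Suc j)
  have "(q j)\<^sup>2 mod 4 = (q j mod 4)\<^sup>2 mod 4" by (simp add: power_mod)
  thus ?case using Suc by (simp add: q_Suc)
qed (simp add: q_def p_mod_4)

lemma p_ge_5: "p \<ge> 5"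
proof -
  have "p \<noteq> 2" "p \<noteq> 3" "p \<noteq> 4" using p_mod_4 by auto
  thus ?thesis using prime_ge_2_nat[OF prime_p] by linarith
qed

lemma q_ge_5: "q j \<ge> 5"
proof -
  have "p ^ 1 \<le> p ^ (2 ^ j)" using p_ge_5 by (intro power_increasing) auto
  thus ?thesis using p_ge_5 by (simp add: q_def)
qed

lemma four_dvd: "4 dvd q j - 1"
  using q_mod_4[of j] q_ge_5[of j] mod_eq_dvd_iff_nat[of 1 "q j" 4] by simp

lemma q_dvd: "j \<le> J \<Longrightarrow> q j - 1 dvd q J - 1"
proof (induction J rule: dec_induct)
  case (step n)
  have "q (Suc n) - 1 = (q n - 1) * (q n + 1)"
    unfolding q_Suc by (cases "q n") (simp_all add: power2_eq_square)
  thus ?case using step.IH by simp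
qed simp

lemma card_F: "j \<le> J \<Longrightarrow> card (F j) = q j"
  using q_ge_5[of j] q_dvd[of j] by (intro card_fixed) (auto simp: q_def)

lemma F_top: "F J = carrier R"
  using pow_card by (auto simp: fixed_def q_def)

section \<open>The quartic characters\<close>

lemma omega_closed: "omega \<in> carrier R"
  by (simp add: omega_def gen_closed)

lemma omega_pow_eq_iff: "omega [^] i = omega [^] (k::nat) \<longleftrightarrow> [i = k] (mod 4)"
proof -
  obtain m where m: "q J - 1 = 4 * m" using four_dvd by blast
  have m0: "m > 0" using m q_ge_5[of J] by (intro gr0I) auto
  have "omega [^] i = omega [^] k \<longleftrightarrow> gen [^] (m * i) = gen [^] (m * k)"
    unfolding omega_def m by (simp add: nat_pow_pow gen_closed)
  also have "\<dots> \<longleftrightarrow> [m * i = m * k] (mod (m * 4))"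
    unfolding gen_pow_eq_iff using m by (simp add: q_def mult.commute)
  also have "\<dots> \<longleftrightarrow> [i = k] (mod 4)"
    unfolding cong_def mod_mult_mult1 using m0 by simp
  finally show ?thesis .
qed

lemma quartic_omega: "quartic (omega [^] (i::nat)) = \<i> ^ i"
proof -
  define k where "k = (SOME k. omega [^] i = omega [^] (k::nat))"
  have "omega [^] i = omega [^] k" unfolding k_def by (rule someI[of _ i]) simp
  hence "i mod 4 = k mod 4" by (simp add: omega_pow_eq_iff cong_def)
  hence "\<i> ^ k = (\<i> ^ i :: complex)" by (metis i_power_mod)
  thus ?thesis unfolding quartic_def k_def by auto
qed

lemma quartic_zero: "quartic \<zero> = 0"
proof -
  have "omega [^] (i::nat) \<noteq> \<zero>" for i
    using gen_pow_nonzero by (simp add: omega_def nat_pow_pow gen_closed)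
  hence "\<nexists>i::nat. \<zero> = omega [^] i" by metis
  thus ?thesis unfolding quartic_def by simp
qed

text \<open>The first factor is the exponent of a generator of the nonzero elements of
  \<open>F j\<close>. So this generator, raised to the power that defines \<open>chi j\<close>, is
  \<open>omega\<close>.\<close>

lemma exponent_mult:
  assumes "j \<le> J"
  shows "(q J - 1) div (q j - 1) * ((q j - 1) div 4) = (q J - 1) div 4"
proof -
  have "q J - 1 = (q J - 1) div (q j - 1) * (q j - 1)" using q_dvd[OF assms] by simp
  also have "\<dots> = (q J - 1) div (q j - 1) * ((q j - 1) div 4) * 4" using four_dvd by simp
  finally show ?thesis by (metis nonzero_mult_div_cancel_right zero_neq_numeral)
qed

lemma fixed_pow_omega:
  assumes "j \<le> J" "x \<in> F j" "x \<noteq> \<zero>"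
  obtains i :: nat where "x [^] ((q j - 1) div 4) = omega [^] i"
proof -
  obtain k :: nat where k: "x = gen [^] k" 
    using nonzero_cases[OF fixed_closed[OF assms(2)] assms(3)] by blast
  have "(q J - 1) div (q j - 1) dvd k"
    using assms(2) gen_pow_in_fixed_iff[of "q j" k] q_ge_5[of j] q_dvd[OF assms(1)]
    unfolding k by (simp add: q_def)
  then obtain l where "k = (q J - 1) div (q j - 1) * l" by blast
  hence "k * ((q j - 1) div 4) = (q J - 1) div 4 * l"
    using exponent_mult[OF assms(1)] by (metis mult.assoc mult.commute)
  hence "x [^] ((q j - 1) div 4) = omega [^] l"
    by (simp add: k omega_def nat_pow_pow gen_closed)
  thus thesis by (rule that)
qed

lemma chi_zero: "chi j \<zero> = 0"
proof -
  have "(q j - 1) div 4 \<noteq> 0" using q_ge_5[of j] by simp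
  thus ?thesis by (simp add: chi_def nat_pow_zero quartic_zero)
qed

lemma chi_one: "chi j \<one> = 1"
  using quartic_omega[of 0] by (simp add: chi_def)

lemma chi_cases:
  assumes "j \<le> J" "x \<in> F j" "x \<noteq> \<zero>"
  obtains i :: nat where "chi j x = \<i> ^ i"
  using fixed_pow_omega[OF assms] quartic_omega unfolding chi_def by metis

lemma chi_mult:
  assumes "j \<le> J" "x \<in> F j" "y \<in> F j"
  shows "chi j (x \<otimes> y) = chi j x * chi j y"
proof (cases "x = \<zero> \<or> y = \<zero>")
  case True
  thus ?thesis using assms fixed_closed by (auto simp: chi_zero)
next
  case False
  obtain i :: nat where i: "x [^] ((q j - 1) div 4) = omega [^] i"
    using fixed_pow_omega assms False by blast
  obtain k :: nat where k: "y [^] ((q j - 1) div 4) = omega [^] k"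
    using fixed_pow_omega assms False by blast
  have "(x \<otimes> y) [^] ((q j - 1) div 4) = omega [^] (i + k)"
    unfolding nat_pow_distrib[OF assms(2,3)[THEN fixed_closed]] i k
    by (simp add: nat_pow_mult omega_closed)
  thus ?thesis unfolding chi_def i k by (simp only: quartic_omega power_add)
qed

lemma norm_chi:
  assumes "j \<le> J" "x \<in> F j" "x \<noteq> \<zero>"
  shows "chi j x * cnj (chi j x) = 1" "cnj (chi j x) = chi j x ^ 3" "chi j x ^ 4 = 1" 
proof -
  obtain i :: nat where i: "chi j x = \<i> ^ i" using chi_cases[OF assms] .
  show 1: "chi j x * cnj (chi j x) = 1"
    by (simp add: i power_mult_distrib[symmetric])
  show 4: "chi j x ^ 4 = 1"
    unfolding i power_mult[symmetric] mult.commute[of i 4] by (rule i_power_4)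
  have "cnj (chi j x) = cnj (chi j x) * chi j x ^ 4" by (simp only: 4 mult_1_right)
  also have "\<dots> = (chi j x * cnj (chi j x)) * chi j x ^ 3" by (simp add: eval_nat_numeral)
  also have "\<dots> = chi j x ^ 3" by (simp only: 1 mult_1_left)
  finally show "cnj (chi j x) = chi j x ^ 3" .
qed

lemma ex_chi_eq_i:
  assumes "j \<le> J"
  obtains a where "a \<in> F j" "chi j a = \<i>"
proof
  let ?a = "gen [^] ((q J - 1) div (q j - 1))"
  show "?a \<in> F j"
    using gen_pow_in_fixed_iff[of "q j" "(q J - 1) div (q j - 1)"] q_ge_5[of j] q_dvd[OF assms]
    by (simp add: q_def)
  have "?a [^] ((q j - 1) div 4) = omega [^] (1::nat)"
    unfolding nat_pow_pow[OF gen_closed] exponent_mult[OF assms] omega_def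
    by (simp add: gen_closed)
  thus "chi j ?a = \<i>" using quartic_omega[of 1] by (simp add: chi_def)
qed

text \<open>As \<open>q (Suc j) - 1 = (q j + 1) * (q j - 1)\<close>, the exponent in
  \<open>chi (Suc j)\<close> is \<open>q j + 1\<close> times that in \<open>chi j\<close>, and the
  power \<open>q j + 1\<close> of \<open>x\<close> is its relative norm.\<close>

lemma chi_Suc:
  assumes "x \<in> F (Suc j)"
  shows "chi (Suc j) x = chi j (x \<otimes> x [^] q j)"
proof -
  have x: "x \<in> carrier R" using assms by (rule fixed_closed)
  have "q (Suc j) - 1 = (q j + 1) * (q j - 1)"
    unfolding q_Suc by (cases "q j") (simp_all add: power2_eq_square)
  hence "(q (Suc j) - 1) div 4 = (q j + 1) * ((q j - 1) div 4)"
    using div_mult_swap[OF four_dvd] by simp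
  hence "x [^] ((q (Suc j) - 1) div 4) = (x [^] (q j + 1)) [^] ((q j - 1) div 4)"
    unfolding nat_pow_pow[OF x] by simp
  also have "x [^] (q j + 1) = x \<otimes> x [^] q j" using x by (simp add: m_comm)
  finally show ?thesis by (simp add: chi_def)
qed

lemma bij_mult_fixed:
  assumes "a \<in> fixed d" "a \<noteq> \<zero>"
  shows "bij_betw (\<lambda>x. a \<otimes> x) (fixed d) (fixed d)"
proof -
  have "inj_on (\<lambda>x. a \<otimes> x) (fixed d)"
    using assms fixed_closed by (intro inj_onI) (metis m_lcancel)
  moreover have "(\<lambda>x. a \<otimes> x) ` fixed d \<subseteq> fixed d" using assms fixed_mult by auto
  ultimately show ?thesis
    by (simp add: bij_betw_def endo_inj_surj finite_fixed)
qed

text \<open>Multiplication by an element with character value \<open>\<i>\<close> permutes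
  \<open>F j\<close> and scales the sum by a factor different from 1.\<close>

lemma sum_chi_power:
  assumes "j \<le> J" "\<i> ^ m \<noteq> (1::complex)"
  shows "(\<Sum>x\<in>F j. chi j x ^ m) = 0"
proof -
  obtain a where a: "a \<in> F j" "chi j a = \<i>" using ex_chi_eq_i[OF assms(1)] .
  have "a \<noteq> \<zero>" using a chi_zero[of j] by auto
  have "(\<Sum>x\<in>F j. chi j x ^ m) = (\<Sum>x\<in>F j. chi j (a \<otimes> x) ^ m)"
    by (rule sum.reindex_bij_betw[OF bij_mult_fixed[OF a(1) \<open>a \<noteq> \<zero>\<close>], symmetric])
  also have "\<dots> = (\<Sum>x\<in>F j. \<i> ^ m * chi j x ^ m)"
    by (intro sum.cong) (auto simp: chi_mult[OF assms(1) a(1)] a(2) power_mult_distrib)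
  also have "\<dots> = \<i> ^ m * (\<Sum>x\<in>F j. chi j x ^ m)" by (simp add: sum_distrib_left)
  finally show ?thesis using assms(2) by simp
qed

section \<open>The additive characters and their orthogonality\<close>

lemma add_pow_one_in_fixed: "[(k::nat)] \<cdot> \<one> \<in> fixed (p ^ i)"
proof (induction k)
  case 0
  show ?case using fixed_zero[of "p ^ i"] p_ge_5 by simp
next
  case (Suc k)
  thus ?case using fixed_add[OF Suc fixed_one] by (simp add: add.nat_pow_Suc)
qed

lemma F_0: "F 0 = (\<lambda>k::nat. [k] \<cdot> \<one>) ` {..<p}"
proof (rule card_seteq[symmetric])
  show "finite (F 0)" by (rule finite_fixed)
  show "(\<lambda>k::nat. [k] \<cdot> \<one>) ` {..<p} \<subseteq> F 0"
    using add_pow_one_in_fixed[of _ 1] by (auto simp: q_def)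
  have "inj_on (\<lambda>k::nat. [k] \<cdot> \<one>) {..<p}"
    by (rule inj_onI) (simp add: add_pow_one_eq_iff[OF prime_p char_p])
  thus "card (F 0) \<le> card ((\<lambda>k::nat. [k] \<cdot> \<one>) ` {..<p})"
    by (simp add: card_image card_F) (simp add: q_def)
qed

lemma psi_0: "psi 0 ([(k::nat)] \<cdot> \<one>) = cis (2 * pi * real k / real p)"
proof -
  define l where "l = (SOME l. [k] \<cdot> \<one> = [(l::nat)] \<cdot> \<one>)"
  have "[k] \<cdot> \<one> = [l] \<cdot> \<one>" unfolding l_def by (rule someI[of _ k]) simp
  hence kl: "k mod p = l mod p" by (simp add: add_pow_one_eq_iff[OF prime_p char_p])
  have red: "cis (2 * pi * real n / real p) = cis (2 * pi * real (n mod p) / real p)" for n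
  proof -
    have "real n = real p * real (n div p) + real (n mod p)"
      by (metis mult_div_mod_eq of_nat_add of_nat_mult)
    hence "2 * pi * real n / real p = 2 * pi * real (n mod p) / real p + 2 * pi * real (n div p)"
      using p_ge_5 by (simp add: field_simps)
    thus ?thesis by (simp add: cis_mult[symmetric] cis_multiple_2pi)
  qed
  have "psi 0 ([k] \<cdot> \<one>) = cis (2 * pi * real l / real p)" by (simp add: l_def)
  thus ?thesis using red[of k] red[of l] kl by simp
qed

lemma trace_in_F: "x \<in> F (Suc j) \<Longrightarrow> x \<oplus> x [^] q j \<in> F j"
  and norm_in_F: "x \<in> F (Suc j) \<Longrightarrow> x \<otimes> x [^] q j \<in> F j"
  using trace_norm_in_fixed[of x "2 ^ j"] by (simp_all add: q_Suc) (simp_all add: q_def)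

lemma psi_add: "x \<in> F j \<Longrightarrow> y \<in> F j \<Longrightarrow> psi j (x \<oplus> y) = psi j x * psi j y"
proof (induction j arbitrary: x y)
  case 0
  obtain k l :: nat where kl: "x = [k] \<cdot> \<one>" "y = [l] \<cdot> \<one>" using 0 unfolding F_0 by blast
  have "x \<oplus> y = [(k + l)] \<cdot> \<one>" by (simp add: kl add.nat_pow_mult)
  hence "psi 0 (x \<oplus> y) = cis (2 * pi * real (k + l) / real p)" by (simp only: psi_0)
  thus ?case unfolding kl psi_0 cis_mult by (simp add: algebra_simps add_divide_distrib)
next
  case (Suc j)
  have c: "x \<in> carrier R" "y \<in> carrier R" using Suc.prems fixed_closed by auto
  have "(x \<oplus> y) [^] q j = x [^] q j \<oplus> y [^] q j" using c by (simp add: q_def frobenius)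
  hence "x \<oplus> y \<oplus> (x \<oplus> y) [^] q j = (x \<oplus> x [^] q j) \<oplus> (y \<oplus> y [^] q j)"
    using c by (simp add: a_ac)
  thus ?case using Suc by (simp add: trace_in_F)
qed

lemma norm_psi: "x \<in> F j \<Longrightarrow> cmod (psi j x) = 1"
  by (induction j arbitrary: x) (auto simp: trace_in_F)

lemma psi_zero: "psi j \<zero> = 1"
proof -
  have 0: "\<zero> \<in> F j" using q_ge_5[of j] by (intro fixed_zero) auto
  have "psi j \<zero> \<noteq> 0" using norm_psi[OF 0] by auto
  thus ?thesis using psi_add[OF 0 0] by simp
qed

lemma F_add: "x \<in> F j \<Longrightarrow> y \<in> F j \<Longrightarrow> x \<oplus> y \<in> F j"
  and F_minus: "x \<in> F j \<Longrightarrow> y \<in> F j \<Longrightarrow> x \<ominus> y \<in> F j"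
  and F_uminus: "x \<in> F j \<Longrightarrow> \<ominus> x \<in> F j"
  by (simp_all add: q_def fixed_add fixed_minus fixed_uminus)

lemma cnj_psi:
  assumes "x \<in> F j"
  shows "cnj (psi j x) = psi j (\<ominus> x)"
proof -
  have "psi j x * psi j (\<ominus> x) = 1"
    using assms psi_add[of x j "\<ominus> x"] F_uminus[of x j] fixed_closed[of x]
    by (simp add: r_neg psi_zero)
  moreover have "psi j x * cnj (psi j x) = 1"
    using norm_psi[OF assms] by (simp add: complex_norm_square[symmetric])
  ultimately show ?thesis by (metis mult_cancel_left mult_zero_left zero_neq_one)
qed

text \<open>An element of the prime field has relative trace twice itself, so each level contributes
  a factor 2. As \<open>p\<close> is odd, \<open>psi j\<close> is nontrivial at every level, as
  stated in \<open>psi_one\<close>.\<close>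

lemma psi_add_pow_one: "psi j ([(k::nat)] \<cdot> \<one>) = cis (2 * pi * real (k * 2 ^ j) / real p)"
proof (induction j arbitrary: k)
  case (Suc j)
  have "([k] \<cdot> \<one>) [^] q j = [k] \<cdot> \<one>"
    using add_pow_one_in_fixed[of k "2 ^ j"] by (simp add: fixed_def q_def)
  hence "[k] \<cdot> \<one> \<oplus> ([k] \<cdot> \<one>) [^] q j = [(2 * k)] \<cdot> \<one>"
    by (simp add: add.nat_pow_mult mult_2)
  thus ?case using Suc[of "2 * k"] by (simp add: mult_ac)
next
  case 0
  show ?case unfolding psi_0 by simp
qed

lemma psi_one: "psi j \<one> \<noteq> 1"
proof
  assume "psi j \<one> = 1"
  hence "cis (2 * pi * real (2 ^ j) / real p) = 1"
    using psi_add_pow_one[of j 1] by (simp add: add.nat_pow_eone)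
  hence "cos (2 * pi * real (2 ^ j) / real p) = 1" by (simp add: complex_eq_iff)
  then obtain n :: int where "2 * pi * real (2 ^ j) / real p = of_int n * 2 * pi"
    using cos_one_2pi_int by auto
  hence "real (2 ^ j) = of_int n * real p" using p_ge_5 by (simp add: field_simps)
  hence "int (2 ^ j) = n * int p" by (metis of_int_eq_iff of_int_mult of_int_of_nat_eq)
  hence "p dvd 2 ^ j" by (metis dvd_triv_right int_dvd_int_iff)
  hence "p dvd 2" using prime_p prime_dvd_power by blast
  thus False using p_ge_5 by (auto dest: dvd_imp_le)
qed

lemma sum_psi: "(\<Sum>x\<in>F j. psi j x) = 0"
proof -
  have "(\<Sum>x\<in>F j. psi j x) = (\<Sum>x\<in>F j. psi j (x \<oplus> \<one>))"
  proof (rule sum.reindex_bij_witness[of _ "\<lambda>x. x \<oplus> \<one>" "\<lambda>x. x \<ominus> \<one>"])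
    fix x assume x: "x \<in> F j"
    hence c: "x \<in> carrier R" by (rule fixed_closed)
    show "x \<ominus> \<one> \<oplus> \<one> = x" using c by algebra
    thus "psi j (x \<ominus> \<one> \<oplus> \<one>) = psi j x" by simp
    show "x \<oplus> \<one> \<ominus> \<one> = x" using c by algebra
    show "x \<ominus> \<one> \<in> F j" "x \<oplus> \<one> \<in> F j" using x by (simp_all add: F_minus F_add fixed_one)
  qed
  also have "\<dots> = psi j \<one> * (\<Sum>x\<in>F j. psi j x)"
    by (simp add: psi_add fixed_one sum_distrib_left mult.commute)
  finally show ?thesis using psi_one[of j] by simp
qed

lemma sum_psi_mult:
  assumes "j \<le> J" "a \<in> F j"
  shows "(\<Sum>x\<in>F j. psi j (a \<otimes> x)) = (if a = \<zero> then of_nat (q j) else 0)"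
proof (cases "a = \<zero>")
  case True
  have "(\<Sum>x\<in>F j. psi j (a \<otimes> x)) = (\<Sum>x\<in>F j. 1)"
    using True fixed_closed by (intro sum.cong) (auto simp: psi_zero)
  thus ?thesis using True card_F[OF assms(1)] by simp
next
  case False
  thus ?thesis 
    using sum.reindex_bij_betw[OF bij_mult_fixed[OF assms(2) False], of "psi j"] sum_psi by simp
qed


section \<open>Gauss and Jacobi sums\<close>

text \<open>Climbing one level composes \<open>chi\<close> with the norm and \<open>psi\<close> with
  the trace, which is the situation of \<open>gauss_sum_quadratic_extension\<close>.\<close>

lemma gauss_Suc:
  assumes j: "j < J" and m: "\<i> ^ m \<noteq> (1::complex)"
  shows "gauss (Suc j) m = - (gauss j m)\<^sup>2"
proof -
  have jJ: "j \<le> J" using j by simp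
  have "gauss (Suc j) m =
      (\<Sum>x\<in>fixed ((q j)\<^sup>2). chi j (x \<otimes> x [^] q j) ^ m * psi j (x \<oplus> x [^] q j))"
    unfolding gauss_def q_Suc by (intro sum.cong) (auto simp: chi_Suc q_Suc)
  also have "\<dots> = - (\<Sum>x\<in>F j. chi j x ^ m * psi j x)\<^sup>2"
  proof (rule gauss_sum_quadratic_extension)
    show "q j = p ^ 2 ^ j" "(0::nat) < 2 ^ j" by (simp_all add: q_def)
    show "(q j)\<^sup>2 - 1 dvd p ^ 2 ^ J - 1"
      using q_dvd[of "Suc j"] j by (simp add: q_Suc q_def[of J])
    show "(\<Sum>x\<in>F j. chi j x ^ m) = 0" by (rule sum_chi_power[OF jJ m])
  qed (auto simp: chi_mult[OF jJ] power_mult_distrib psi_add)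
  finally show ?thesis by (simp add: gauss_def)
qed

text \<open>Two steps turn \<open>g\<close> into \<open>- (g ^ 4)\<close>, and each further step
  squares the fourth power and keeps the sign. Counting starts at level 2 because the fourth power
  is what the Jacobi sum determines.\<close>

lemma gauss_tower:
  assumes "k + 2 \<le> J" and m: "\<i> ^ m \<noteq> (1::complex)"
  shows "gauss (k + 2) m = - (((gauss 0 m) ^ 4) ^ (2 ^ k))"
  using assms(1)
proof (induction k)
  case 0
  thus ?case using gauss_Suc[OF _ m, of 0] gauss_Suc[OF _ m, of 1] by (simp add: eval_nat_numeral)
next
  case (Suc k)
  thus ?case using gauss_Suc[OF _ m, of "k + 2"]
    by (simp add: power_mult[symmetric] mult.commute[of 2])
qed

lemma zero_in_F: "\<zero> \<in> F j"
  using q_ge_5[of j] by (intro fixed_zero) auto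

lemma chi_uminus_one:
  assumes "j \<le> J"
  shows "chi j (\<ominus> \<one>) ^ 2 = 1"
proof -
  have "\<ominus> \<one> \<in> F j" by (intro F_uminus fixed_one)
  hence "chi j (\<ominus> \<one> \<otimes> \<ominus> \<one>) = chi j (\<ominus> \<one>) ^ 2"
    using assms by (simp add: chi_mult power2_eq_square)
  moreover have "\<ominus> \<one> \<otimes> \<ominus> \<one> = \<one>" by algebra
  ultimately show ?thesis by (simp add: chi_one)
qed

lemma chi_uminus:
  assumes "j \<le> J" "x \<in> F j"
  shows "chi j (\<ominus> x) = chi j (\<ominus> \<one>) * chi j x"
proof -
  have x: "x \<in> carrier R" using assms(2) by (rule fixed_closed)
  have "\<ominus> x = \<ominus> \<one> \<otimes> x" using x by algebra
  thus ?thesis using assms by (simp add: chi_mult F_uminus fixed_one)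
qed

lemma cnj_chi:
  assumes "j \<le> J" "x \<in> F j"
  shows "cnj (chi j x) = chi j x ^ 3"
  using norm_chi(2)[OF assms] by (cases "x = \<zero>") (auto simp: chi_zero)

lemma sum_uminus_F: "(\<Sum>x\<in>F j. f (\<ominus> x)) = (\<Sum>x\<in>F j. f x)"
  by (rule sum.reindex_bij_witness[of _ "\<lambda>x. \<ominus> x" "\<lambda>x. \<ominus> x"])
    (auto simp: F_uminus dest: fixed_closed)

text \<open>Conjugation cubes \<open>chi j\<close> and negates the argument of \<open>psi j\<close>.
  Substituting \<open>\<ominus> x\<close> moves the sign to \<open>chi j\<close>, and its value at
  \<open>\<ominus> \<one>\<close> equals its own cube.\<close>

lemma cnj_gauss:
  assumes j: "j \<le> J"
  shows "cnj (gauss j m) = chi j (\<ominus> \<one>) ^ m * gauss j (3 * m)"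
proof -
  have c: "chi j (\<ominus> \<one>) * chi j (\<ominus> \<one>) = 1" 
    using chi_uminus_one[OF j] by (simp add: power2_eq_square)
  have "cnj (gauss j m) = (\<Sum>x\<in>F j. chi j x ^ (3 * m) * psi j (\<ominus> x))"
    unfolding gauss_def cnj_sum
    by (intro sum.cong refl) (simp add: cnj_psi cnj_chi[OF j] power_mult)
  also have "\<dots> = (\<Sum>x\<in>F j. chi j (\<ominus> x) ^ (3 * m) * psi j x)"
    using sum_uminus_F[of "\<lambda>x. chi j (\<ominus> x) ^ (3 * m) * psi j x" j, symmetric]
    by (auto intro!: sum.cong dest: fixed_closed)
  also have "\<dots> = (\<Sum>x\<in>F j. chi j (\<ominus> \<one>) ^ (3 * m) * (chi j x ^ (3 * m) * psi j x))"
    by (intro sum.cong refl) (simp add: chi_uminus[OF j] power_mult_distrib)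
  also have "\<dots> = chi j (\<ominus> \<one>) ^ (3 * m) * gauss j (3 * m)"
    by (simp add: gauss_def sum_distrib_left)
  also have "chi j (\<ominus> \<one>) ^ (3 * m) = chi j (\<ominus> \<one>) ^ m"
    unfolding power_mult using c by (simp add: eval_nat_numeral)
  finally show ?thesis .
qed

lemma gauss_norm:
  assumes j: "j \<le> J" and m: "\<i> ^ m \<noteq> (1::complex)"
  shows "gauss j m * cnj (gauss j m) = of_nat (q j)"
proof -
  let ?F' = "F j - {\<zero>}"
  have F': "(\<Sum>x\<in>?F'. f x) = (\<Sum>x\<in>F j. f x) - f \<zero>" for f :: "'a \<Rightarrow> complex"
    using zero_in_F by (subst sum_diff1) (auto simp: finite_fixed)
  have m0: "m \<noteq> 0" using m by (cases m) auto
  have "gauss j m * cnj (gauss j m) =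
      (\<Sum>y\<in>F j. \<Sum>x\<in>F j. (chi j x ^ m * psi j x) * (cnj (chi j y) ^ m * cnj (psi j y)))"
    unfolding gauss_def cnj_sum sum_product by (subst sum.swap) simp
  \<comment> \<open>The terms with \<open>y = \<zero>\<close> vanish. For the other \<open>y\<close>
    the substitution \<open>x = y \<otimes> t\<close> removes \<open>y\<close> from the
    multiplicative character.\<close>
  also have "\<dots> = (\<Sum>y\<in>?F'. \<Sum>x\<in>F j. (chi j x ^ m * psi j x) * (cnj (chi j y) ^ m * cnj (psi j y)))"
    unfolding F' using m0 by (simp add: chi_zero power_0_left)
  also have "\<dots> = (\<Sum>y\<in>?F'. \<Sum>t\<in>F j. chi j t ^ m * psi j ((t \<ominus> \<one>) \<otimes> y))"
  proof (rule sum.cong[OF refl])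
    fix y assume y: "y \<in> ?F'"
    have yF: "y \<in> F j" "y \<noteq> \<zero>" "y \<in> carrier R" using y fixed_closed by auto
    have "(\<Sum>x\<in>F j. (chi j x ^ m * psi j x) * (cnj (chi j y) ^ m * cnj (psi j y))) =
      (\<Sum>t\<in>F j. (chi j (y \<otimes> t) ^ m * psi j (y \<otimes> t)) * (cnj (chi j y) ^ m * cnj (psi j y)))"
      by (rule sum.reindex_bij_betw[OF bij_mult_fixed[OF yF(1,2)], symmetric])
    also have "\<dots> = (\<Sum>t\<in>F j. chi j t ^ m * psi j ((t \<ominus> \<one>) \<otimes> y))"
    proof (rule sum.cong[OF refl])
      fix t assume t: "t \<in> F j"
      hence tc: "t \<in> carrier R" by (rule fixed_closed)
      have yt: "y \<otimes> t \<in> F j" using yF t by (simp add: fixed_mult)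
      have "(t \<ominus> \<one>) \<otimes> y = y \<otimes> t \<oplus> \<ominus> y" using tc yF(3) by algebra
      hence "psi j ((t \<ominus> \<one>) \<otimes> y) = psi j (y \<otimes> t) * cnj (psi j y)"
        using yt yF by (simp add: psi_add F_uminus cnj_psi)
      moreover have "chi j (y \<otimes> t) ^ m * cnj (chi j y) ^ m = chi j t ^ m"
        unfolding power_mult_distrib[symmetric] chi_mult[OF j yF(1) t]
        using norm_chi(1)[OF j yF(1,2)] by (simp add: mult_ac)
      ultimately show "(chi j (y \<otimes> t) ^ m * psi j (y \<otimes> t)) * (cnj (chi j y) ^ m * cnj (psi j y)) =
          chi j t ^ m * psi j ((t \<ominus> \<one>) \<otimes> y)"
        by (simp add: mult_ac)
    qed
    finally show "(\<Sum>x\<in>F j. (chi j x ^ m * psi j x) * (cnj (chi j y) ^ m * cnj (psi j y))) =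
      (\<Sum>t\<in>F j. chi j t ^ m * psi j ((t \<ominus> \<one>) \<otimes> y))" .
  qed
  also have "\<dots> = (\<Sum>t\<in>F j. chi j t ^ m * (\<Sum>y\<in>?F'. psi j ((t \<ominus> \<one>) \<otimes> y)))"
    by (subst sum.swap) (simp add: sum_distrib_left)
  \<comment> \<open>Orthogonality evaluates the sum over all \<open>y\<close>; the missing
    \<open>y = \<zero>\<close> accounts for the \<open>- 1\<close>. That part contributes a
    vanishing sum of \<open>chi j t ^ m\<close>, so only \<open>t = \<one>\<close> survives.\<close>
  also have "\<dots> = (\<Sum>t\<in>F j. chi j t ^ m * ((if t = \<one> then of_nat (q j) else 0) - 1))"
  proof (rule sum.cong[OF refl])
    fix t assume t: "t \<in> F j"
    hence tc: "t \<in> carrier R" by (rule fixed_closed)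
    have "(\<Sum>y\<in>?F'. psi j ((t \<ominus> \<one>) \<otimes> y)) = (if t \<ominus> \<one> = \<zero> then of_nat (q j) else 0) - 1"
      unfolding F' using t tc
      by (subst sum_psi_mult[OF j]) (auto simp: F_minus fixed_one psi_zero)
    thus "chi j t ^ m * (\<Sum>y\<in>?F'. psi j ((t \<ominus> \<one>) \<otimes> y)) =
        chi j t ^ m * ((if t = \<one> then of_nat (q j) else 0) - 1)"
      using tc by simp
  qed
  also have "\<dots> = (\<Sum>t\<in>F j. if t = \<one> then chi j t ^ m * of_nat (q j) else 0) - (\<Sum>t\<in>F j. chi j t ^ m)"
    unfolding sum_subtractf[symmetric] by (intro sum.cong) (auto simp: algebra_simps)
  also have "\<dots> = of_nat (q j)"
    unfolding sum_chi_power[OF j m]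
    by (subst sum.delta'[OF finite_fixed] | subst sum.delta[OF finite_fixed])+ (simp add: fixed_one chi_one)
  finally show ?thesis .
qed

section \<open>The Jacobi sum and the fourth power of the quartic Gauss sum\<close>

definition jacobi :: "nat \<Rightarrow> complex" where
  "jacobi j = (\<Sum>x\<in>F j. chi j x * chi j (\<one> \<ominus> x))"

text \<open>Pairs are grouped by their sum \<open>t\<close>. For \<open>t \<noteq> \<zero>\<close>,
  scaling by \<open>t\<close> extracts \<open>chi j t ^ 2\<close>; for \<open>t = \<zero>\<close>
  what remains is a multiple of the sum of \<open>chi j x ^ 2\<close>, which is 0.\<close>

lemma gauss_jacobi:
  assumes j: "j \<le> J"
  shows "(gauss j 1)\<^sup>2 = jacobi j * gauss j 2"
proof -
  have "(gauss j 1)\<^sup>2 = (\<Sum>x\<in>F j. \<Sum>y\<in>F j. (chi j x * psi j x) * (chi j y * psi j y))"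
    unfolding gauss_def power2_eq_square sum_product by simp
  also have "\<dots> = (\<Sum>x\<in>F j. \<Sum>t\<in>F j. chi j x * chi j (t \<ominus> x) * psi j t)"
  proof (rule sum.cong[OF refl])
    fix x assume x: "x \<in> F j"
    hence xc: "x \<in> carrier R" by (rule fixed_closed)
    show "(\<Sum>y\<in>F j. (chi j x * psi j x) * (chi j y * psi j y)) =
      (\<Sum>t\<in>F j. chi j x * chi j (t \<ominus> x) * psi j t)"
    proof (rule sum.reindex_bij_witness[of _ "\<lambda>t. t \<ominus> x" "\<lambda>y. x \<oplus> y"])
      fix y assume y: "y \<in> F j"
      hence yc: "y \<in> carrier R" by (rule fixed_closed)
      show 1: "x \<oplus> y \<ominus> x = y" using xc yc by algebra
      show "x \<oplus> y \<in> F j" "y \<ominus> x \<in> F j" using x y by (simp_all add: F_add F_minus)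
      show "x \<oplus> (y \<ominus> x) = y" using xc yc by algebra
      show "chi j x * chi j (x \<oplus> y \<ominus> x) * psi j (x \<oplus> y) =
        (chi j x * psi j x) * (chi j y * psi j y)"
        unfolding 1 psi_add[OF x y] by (simp add: mult_ac)
    qed
  qed
  also have "\<dots> = (\<Sum>t\<in>F j. psi j t * (\<Sum>x\<in>F j. chi j x * chi j (t \<ominus> x)))"
    by (subst sum.swap) (simp add: sum_distrib_left mult_ac)
  also have "\<dots> = (\<Sum>t\<in>F j. psi j t * (chi j t ^ 2 * jacobi j))"
  proof (rule sum.cong[OF refl])
    fix t assume t: "t \<in> F j"
    hence tc: "t \<in> carrier R" by (rule fixed_closed)
    have "(\<Sum>x\<in>F j. chi j x * chi j (t \<ominus> x)) = chi j t ^ 2 * jacobi j"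
    proof (cases "t = \<zero>")
      case True
      have "(\<Sum>x\<in>F j. chi j x * chi j (t \<ominus> x)) = (\<Sum>x\<in>F j. chi j (\<ominus> \<one>) * chi j x ^ 2)"
      proof (rule sum.cong[OF refl])
        fix x assume x: "x \<in> F j"
        hence "x \<in> carrier R" by (rule fixed_closed)
        hence "t \<ominus> x = \<ominus> x" unfolding True by algebra
        thus "chi j x * chi j (t \<ominus> x) = chi j (\<ominus> \<one>) * chi j x ^ 2"
          using chi_uminus[OF j x] by (simp add: power2_eq_square)
      qed
      also have "\<dots> = chi j (\<ominus> \<one>) * (\<Sum>x\<in>F j. chi j x ^ 2)" by (simp add: sum_distrib_left)
      also have "\<dots> = 0" using sum_chi_power[OF j, of 2] by simp
      finally show ?thesis by (simp add: True chi_zero)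
    next
      case False
      have "(\<Sum>x\<in>F j. chi j x * chi j (t \<ominus> x)) =
          (\<Sum>u\<in>F j. chi j (t \<otimes> u) * chi j (t \<ominus> t \<otimes> u))"
        by (rule sum.reindex_bij_betw[OF bij_mult_fixed[OF t False], symmetric])
      also have "\<dots> = (\<Sum>u\<in>F j. chi j t ^ 2 * (chi j u * chi j (\<one> \<ominus> u)))"
      proof (rule sum.cong[OF refl])
        fix u assume u: "u \<in> F j"
        hence uc: "u \<in> carrier R" by (rule fixed_closed)
        have "t \<ominus> t \<otimes> u = t \<otimes> (\<one> \<ominus> u)" using tc uc by algebra
        thus "chi j (t \<otimes> u) * chi j (t \<ominus> t \<otimes> u) = chi j t ^ 2 * (chi j u * chi j (\<one> \<ominus> u))"
          using t u by (simp add: chi_mult[OF j] F_minus fixed_one power2_eq_square)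
      qed
      finally show ?thesis by (simp add: jacobi_def sum_distrib_left)
    qed
    thus "psi j t * (\<Sum>x\<in>F j. chi j x * chi j (t \<ominus> x)) = psi j t * (chi j t ^ 2 * jacobi j)" by simp
  qed
  also have "\<dots> = jacobi j * gauss j 2"
    unfolding gauss_def by (simp add: sum_distrib_left mult_ac)
  finally show ?thesis .
qed

lemma jacobi_gaussian: "jacobi j \<in> gaussian_ints"
proof -
  have "quartic x \<in> gaussian_ints" for x
    by (auto simp: quartic_def intro!: gaussian_ints_power gaussian_ints_i gaussian_ints_0)
  thus ?thesis
    unfolding jacobi_def chi_def by (intro gaussian_ints_sum gaussian_ints_mult)
qed

lemma i_power_ne_1: "\<i> ^ Suc 0 \<noteq> (1::complex)" "\<i> ^ 2 \<noteq> (1::complex)" "\<i> ^ 3 \<noteq> (1::complex)"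
  by (simp_all add: complex_eq_iff eval_nat_numeral)

lemma chi_power_add_4:
  assumes "j \<le> J" "x \<in> F j" "m > 0"
  shows "chi j x ^ (m + 4) = chi j x ^ m"
  using norm_chi(3)[OF assms(1,2)] assms(3)
  by (cases "x = \<zero>") (auto simp: chi_zero power_add power_0_left)

text \<open>The quadratic Gauss sum is real: \<open>chi j ^ 6\<close> and \<open>chi j ^ 2\<close>
  agree, and \<open>chi j (\<ominus> \<one>) ^ 2 = 1\<close>. Hence its square is its squared
  absolute value.\<close>

lemma gauss_2_squared:
  assumes j: "j \<le> J"
  shows "(gauss j 2)\<^sup>2 = of_nat (q j)"
proof -
  have "gauss j (3 * 2) = gauss j 2"
    unfolding gauss_def
  proof (rule sum.cong[OF refl])
    fix x assume "x \<in> F j"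
    thus "chi j x ^ (3 * 2) * psi j x = chi j x ^ 2 * psi j x"
      using chi_power_add_4[OF j, of x 2] by simp
  qed
  hence "cnj (gauss j 2) = gauss j 2"
    using cnj_gauss[OF j, of 2] by (simp add: chi_uminus_one[OF j])
  thus ?thesis using gauss_norm[OF j i_power_ne_1(2)] by (simp add: power2_eq_square)
qed

lemma gauss_1_fourth:
  assumes "j \<le> J"
  shows "gauss j 1 ^ 4 = of_nat (q j) * (jacobi j)\<^sup>2"
proof -
  have "gauss j 1 ^ 4 = ((gauss j 1)\<^sup>2)\<^sup>2" by (simp add: power_mult[symmetric])
  thus ?thesis
    unfolding gauss_jacobi[OF assms] power_mult_distrib gauss_2_squared[OF assms] by simp
qed

lemma gauss_3_fourth:
  assumes j: "j \<le> J"
  shows "gauss j 3 ^ 4 = cnj (gauss j 1 ^ 4)"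
proof -
  have "chi j (\<ominus> \<one>) ^ 4 = (chi j (\<ominus> \<one>) ^ 2) ^ 2" by (simp add: power_mult[symmetric])
  hence "chi j (\<ominus> \<one>) ^ 4 = 1" by (simp add: chi_uminus_one[OF j])
  thus ?thesis using cnj_gauss[OF j, of 1] by (simp add: power_mult_distrib)
qed

lemma norm_jacobi:
  assumes j: "j \<le> J"
  shows "(cmod (jacobi j))\<^sup>2 = real (q j)"
proof -
  have g: "(cmod (gauss j m))\<^sup>2 = real (q j)" if "\<i> ^ m \<noteq> (1::complex)" for m
  proof -
    have "complex_of_real ((cmod (gauss j m))\<^sup>2) = of_nat (q j)"
      using gauss_norm[OF j that] by (simp only: complex_norm_square)
    thus ?thesis by (metis of_real_eq_iff of_real_of_nat_eq)
  qed
  have "((cmod (gauss j 1))\<^sup>2)\<^sup>2 = (cmod (jacobi j))\<^sup>2 * (cmod (gauss j 2))\<^sup>2"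
    using arg_cong[OF gauss_jacobi[OF j], of cmod]
    by (simp add: norm_power norm_mult power_mult_distrib)
  moreover have "(cmod (gauss j 1))\<^sup>2 = real (q j)" "(cmod (gauss j 2))\<^sup>2 = real (q j)"
    using i_power_ne_1 by (auto intro!: g)
  ultimately show ?thesis using q_ge_5[of j] by (simp add: power2_eq_square)
qed


section \<open>The Gaussian periods\<close>

text \<open>The Gaussian period: the eigenvalue of the residue graph on the additive character that
  sends \<open>x\<close> to \<open>psi J (a \<otimes> x)\<close>. At \<open>a = \<zero>\<close> it
  is the degree.\<close>

definition period :: "'a \<Rightarrow> complex" where
  "period a = (\<Sum>s\<in>power_residues 4 R. psi J (a \<otimes> s))"

lemma power_residues_4: "power_residues 4 R = {x \<in> carrier R. chi J x = 1}"
proof -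
  have chi: "chi J (gen [^] (i::nat)) = \<i> ^ i" for i
  proof -
    have "(gen [^] i) [^] ((q J - 1) div 4) = omega [^] i"
      by (simp add: omega_def nat_pow_pow gen_closed mult.commute)
    thus ?thesis using quartic_omega[of i] by (simp add: chi_def)
  qed
  show ?thesis
  proof (rule Set.set_eqI, rule iffI)
    fix x assume "x \<in> power_residues 4 R"
    then obtain y where y: "y \<in> carrier R" "y \<noteq> \<zero>" "x = y [^] (4::nat)"
      unfolding power_residues_def by blast
    obtain l :: nat where "y = gen [^] l" using nonzero_cases[OF y(1,2)] .
    hence "x = gen [^] (4 * l)" by (simp add: y nat_pow_pow gen_closed mult.commute)
    thus "x \<in> {x \<in> carrier R. chi J x = 1}" by (simp add: chi i_power_4 gen_closed)
  next
    fix x assume x: "x \<in> {x \<in> carrier R. chi J x = 1}"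
    hence "x \<in> carrier R" "x \<noteq> \<zero>" using chi_zero[of J] by auto
    then obtain k :: nat where k: "x = gen [^] k" by (rule nonzero_cases)
    have "\<i> ^ (k mod 4) = (1::complex)" using x unfolding k by (simp add: chi i_power_mod)
    moreover have "k mod 4 \<in> {0, 1, 2, 3}" by auto
    ultimately have "k mod 4 = 0" using i_power_ne_1 by auto
    then obtain l where "k = 4 * l" by blast
    hence "x = (gen [^] l) [^] (4::nat)" by (simp add: k nat_pow_pow gen_closed mult.commute)
    moreover have "gen [^] l \<in> carrier R - {\<zero>}" using gen_closed gen_pow_nonzero by simp
    ultimately show "x \<in> power_residues 4 R" unfolding power_residues_def by blast
  qed
qed

text \<open>For a fourth root of unity \<open>c\<close> the sum \<open>1 + c + c ^ 2 + c ^ 3\<close>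
  is 4 or 0. This expands the indicator of the fourth powers in characters, with a correction at
  \<open>\<zero>\<close>.\<close>

lemma sum_chi_powers:
  assumes "x \<in> carrier R"
  shows "chi J x + chi J x ^ 2 + chi J x ^ 3 =
    4 * (if chi J x = 1 then 1 else 0) - (if x = \<zero> then 0 else 1)"
proof (cases "x = \<zero>")
  case False
  hence "chi J x ^ 4 = 1" using assms F_top by (intro norm_chi) auto
  hence "(chi J x - 1) * (1 + chi J x + chi J x ^ 2 + chi J x ^ 3) = 0"
    by (simp add: algebra_simps eval_nat_numeral)
  hence "chi J x = 1 \<or> 1 + chi J x + chi J x ^ 2 + chi J x ^ 3 = 0" by simp
  thus ?thesis using False by (auto simp: algebra_simps add_eq_0_iff)
qed (simp add: chi_zero)

lemma four_sum_power_residues: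
  "4 * (\<Sum>x\<in>power_residues 4 R. f x) =
    (\<Sum>x\<in>carrier R. f x) - f \<zero> + (\<Sum>x\<in>carrier R. chi J x * f x) +
    (\<Sum>x\<in>carrier R. chi J x ^ 2 * f x) + (\<Sum>x\<in>carrier R. chi J x ^ 3 * f x)"
proof -
  have "(\<Sum>x\<in>carrier R. chi J x * f x) + (\<Sum>x\<in>carrier R. chi J x ^ 2 * f x) +
      (\<Sum>x\<in>carrier R. chi J x ^ 3 * f x) =
    (\<Sum>x\<in>carrier R. (chi J x + chi J x ^ 2 + chi J x ^ 3) * f x)"
    by (simp add: sum.distrib algebra_simps)
  also have "\<dots> = (\<Sum>x\<in>carrier R. 4 * (if chi J x = 1 then f x else 0) -
      (f x - (if x = \<zero> then f x else 0)))"
    by (intro sum.cong refl) (auto simp: sum_chi_powers)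
  also have "\<dots> = 4 * (\<Sum>x\<in>carrier R. if chi J x = 1 then f x else 0) -
      ((\<Sum>x\<in>carrier R. f x) - (\<Sum>x\<in>carrier R. if x = \<zero> then f x else 0))"
    by (simp add: sum_subtractf sum_distrib_left)
  also have "(\<Sum>x\<in>carrier R. if x = \<zero> then f x else 0) = f \<zero>"
    using finite_carrier by (simp add: sum.delta)
  also have "(\<Sum>x\<in>carrier R. if chi J x = 1 then f x else 0) = (\<Sum>x\<in>power_residues 4 R. f x)"
    unfolding power_residues_4 using finite_carrier by (simp add: sum.inter_filter)
  finally show ?thesis by (simp add: algebra_simps)
qed

lemma sum_chi_carrier: "\<i> ^ m \<noteq> (1::complex) \<Longrightarrow> (\<Sum>x\<in>carrier R. chi J x ^ m) = 0"
  using sum_chi_power[of J m] F_top by simp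

lemma card_power_residues: "4 * card (power_residues 4 R) = q J - 1"
proof -
  have "complex_of_nat (4 * card (power_residues 4 R)) = of_nat (card (carrier R)) - 1"
    using four_sum_power_residues[of "\<lambda>_. 1"] i_power_ne_1[THEN sum_chi_carrier] by simp
  also have "\<dots> = of_nat (q J - 1)"
    using card_F[of J] F_top q_ge_5[of J] by (simp add: of_nat_diff)
  finally show ?thesis by (simp only: of_nat_eq_iff)
qed

section \<open>Evaluation of the periods by Gauss sums\<close>

lemma twisted_sum:
  assumes a: "a \<in> carrier R" "a \<noteq> \<zero>"
  shows "(\<Sum>x\<in>carrier R. chi J x ^ m * psi J (a \<otimes> x)) = cnj (chi J a) ^ m * gauss J m"
proof -
  have aF: "a \<in> F J" using a F_top by simp
  have "cnj (chi J a) ^ m * gauss J m =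
      cnj (chi J a) ^ m * (\<Sum>x\<in>F J. chi J (a \<otimes> x) ^ m * psi J (a \<otimes> x))"
    unfolding gauss_def
    using sum.reindex_bij_betw[OF bij_mult_fixed[OF aF a(2)], of "\<lambda>x. chi J x ^ m * psi J x"]
    by simp
  also have "\<dots> = (\<Sum>x\<in>F J. (chi J a * cnj (chi J a)) ^ m * (chi J x ^ m * psi J (a \<otimes> x)))"
    unfolding sum_distrib_left
    by (intro sum.cong refl) (simp add: chi_mult[OF order_refl aF] power_mult_distrib)
  also have "\<dots> = (\<Sum>x\<in>carrier R. chi J x ^ m * psi J (a \<otimes> x))"
    using norm_chi(1)[OF order_refl aF a(2)] F_top by simp
  finally show ?thesis by simp
qed

lemma period_gauss:
  assumes a: "a \<in> carrier R" "a \<noteq> \<zero>"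
  shows "4 * period a = - 1 + cnj (chi J a) * gauss J 1 + cnj (chi J a) ^ 2 * gauss J 2 +
    cnj (chi J a) ^ 3 * gauss J 3"
proof -
  have "(\<Sum>x\<in>carrier R. psi J (a \<otimes> x)) = 0"
    using sum_psi_mult[of J a] a F_top by simp
  thus ?thesis
    unfolding period_def four_sum_power_residues
    using a twisted_sum[OF a, of 1] twisted_sum[OF a, of 2] twisted_sum[OF a, of 3]
    by (simp add: psi_zero)
qed

text \<open>\<open>gauss_tower\<close> is combined with the fourth powers on the prime field: for
  \<open>m = 1\<close> it is \<open>p\<close> times the square of the Jacobi sum, for
  \<open>m = 3\<close> the conjugate, for \<open>m = 2\<close> the square of
  \<open>p\<close>.\<close>

lemma gauss_top:
  assumes J: "J = k + 2"
  defines "Z \<equiv> jacobi 0 ^ (2 ^ Suc k)"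
  shows "gauss J 1 = - (of_nat (q k) * Z)" "gauss J 3 = - (of_nat (q k) * cnj Z)"
    "gauss J 2 = - (of_nat (q k))\<^sup>2"
proof -
  have tower: "gauss J m = - ((gauss 0 m ^ 4) ^ (2 ^ k))" if "\<i> ^ m \<noteq> (1::complex)" for m
    using gauss_tower[of k m] that J by simp
  have 1: "(gauss 0 1 ^ 4) ^ (2 ^ k) = of_nat (q k) * Z"
    unfolding gauss_1_fourth[OF le0] Z_def
    by (simp add: power_mult_distrib power_mult[symmetric] q_def)
  show "gauss J 1 = - (of_nat (q k) * Z)"
    using tower[of 1] 1 i_power_ne_1(1) by simp
  have "(gauss 0 3 ^ 4) ^ (2 ^ k) = cnj ((gauss 0 1 ^ 4) ^ (2 ^ k))"
    unfolding gauss_3_fourth[OF le0] by simp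
  thus "gauss J 3 = - (of_nat (q k) * cnj Z)"
    unfolding 1 using tower[OF i_power_ne_1(3)] by simp
  have "gauss 0 2 ^ 4 = ((gauss 0 2)\<^sup>2)\<^sup>2" by (simp add: power_mult[symmetric])
  hence "gauss 0 2 ^ 4 = (of_nat (q 0))\<^sup>2" by (simp only: gauss_2_squared[OF le0])
  hence "(gauss 0 2 ^ 4) ^ (2 ^ k) = (of_nat (q k))\<^sup>2"
    by (simp add: power_mult[symmetric] q_def mult.commute)
  thus "gauss J 2 = - (of_nat (q k))\<^sup>2"
    using tower[OF i_power_ne_1(2)] by simp
qed

text \<open>The terms for \<open>m = 1\<close> and \<open>m = 3\<close> are conjugate to each other,
  and \<open>chi J a ^ 2\<close> is 1 or -1, so the period is real.\<close>

lemma period_top: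
  assumes J: "J = k + 2" and a: "a \<in> carrier R" "a \<noteq> \<zero>"
  defines "Z \<equiv> jacobi 0 ^ (2 ^ Suc k)" and "P \<equiv> real (q k)"
  shows "4 * period a = complex_of_real
    (- 1 - P * (2 * Re (cnj (chi J a) * Z) + Re (chi J a ^ 2) * P))"
proof -
  let ?w = "cnj (chi J a)"
  have aF: "a \<in> F J" using a F_top by simp
  have w3: "?w ^ 3 = cnj ?w" using norm_chi(2)[OF order_refl aF a(2)]
    by (metis complex_cnj_cnj complex_cnj_power)
  obtain i :: nat where "chi J a = \<i> ^ i" using chi_cases[OF order_refl aF a(2)] .
  hence "chi J a ^ 2 = (-1) ^ i" by (simp add: power_mult[symmetric] mult.commute[of i])
  hence w2: "?w ^ 2 = of_real (Re (chi J a ^ 2))"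
    by (metis Reals_cnj_iff Reals_1 Reals_minus Reals_power complex_cnj_power of_real_Re)
  have "4 * period a = - 1 - of_real P * (?w * Z + cnj (?w * Z) + ?w ^ 2 * of_real P)"
    unfolding period_gauss[OF a] gauss_top[OF J] w3 Z_def P_def
    by (simp add: algebra_simps power2_eq_square)
  also have "\<dots> = complex_of_real (- 1 - P * (2 * Re (?w * Z) + Re (chi J a ^ 2) * P))"
    unfolding complex_add_cnj w2 by simp
  finally show ?thesis .
qed

section \<open>Signs of the periods\<close>

lemma norm_diff_of_sign:
  fixes r :: real
  shows "r \<ge> 1 \<Longrightarrow> cmod (1 + of_real r) - cmod (of_real r) = 1"
    and "r \<le> - 1 \<Longrightarrow> cmod (1 + of_real r) - cmod (of_real r) = - 1"
  using norm_of_real[of "1 + r", where ?'a = complex] by (simp_all add: norm_of_real)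

text \<open>
  With \<open>P = p ^ 2 ^ k\<close>, the number \<open>4 * period a + 1\<close> is \<open>-P (P + 2 A)\<close>, \<open>-P (2 B - P)\<close>, \<open>-P (P - 2 A)\<close>,
  \<open>-P (-2 B - P)\<close> for \<open>chi J a = 1, \<i>, -1, -\<i>\<close>. As \<open>A\<^sup>2 + B\<^sup>2 = P\<^sup>2\<close> and \<open>2 \<bar>A\<bar> < P\<close> imply \<open>2 \<bar>B\<bar> > P\<close>,
  exactly three of these are negative. The difference is written through \<open>chi\<close> so that it can be
  summed by orthogonality; \<open>e\<close> is the sign that decides which of \<open>\<i>\<close> and \<open>-\<i>\<close> gives the positive
  value.
\<close>

lemma norm_diff_period:
  assumes J: "J = k + 2" and Z: "jacobi 0 ^ (2 ^ Suc k) = Complex (of_int A) (of_int B)"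
    and A: "2 * \<bar>A\<bar> < int (q k)"
  obtains e :: real where "\<And>a. a \<in> carrier R \<Longrightarrow> a \<noteq> \<zero> \<Longrightarrow>
     cmod (1 + period a) - cmod (period a) = - (1 + Re (chi J a ^ 2)) / 2 + e * Im (chi J a)"
proof -
  define P where "P = int (q k)"
  have P5: "P \<ge> 5" using q_ge_5[of k] by (simp add: P_def)
  have "(cmod (jacobi 0 ^ (2 ^ Suc k)))\<^sup>2 = ((cmod (jacobi 0))\<^sup>2) ^ (2 ^ Suc k)"
    by (simp add: norm_power power_mult[symmetric] mult.commute)
  also have "\<dots> = real p ^ (2 ^ Suc k)" using norm_jacobi[of 0] by (simp add: q_def)
  also have "\<dots> = (real_of_int P)\<^sup>2" by (simp add: P_def q_def power_mult[symmetric] mult.commute)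
  finally have "real_of_int (A\<^sup>2 + B\<^sup>2) = real_of_int (P\<^sup>2)"
    unfolding Z by (simp add: cmod_power2)
  hence AB: "A\<^sup>2 + B\<^sup>2 = P\<^sup>2" by (simp only: of_int_eq_iff)
  have "(2 * \<bar>A\<bar>)\<^sup>2 < P\<^sup>2" using A by (intro power_strict_mono) (auto simp: P_def)
  hence "4 * A\<^sup>2 < P\<^sup>2" by (simp add: power_mult_distrib)
  hence "P\<^sup>2 < 4 * B\<^sup>2" using AB zero_le_power2[of P] by linarith
  hence "P\<^sup>2 < (2 * \<bar>B\<bar>)\<^sup>2" by (simp add: power_mult_distrib)
  hence B: "P < 2 * \<bar>B\<bar>" by (rule power_less_imp_less_base) simp
  define e :: real where "e = (if B > 0 then - 1 else 1)"
  show thesis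
  proof (rule that[of e])
    fix a assume a: "a \<in> carrier R" "a \<noteq> \<zero>"
    let ?c = "chi J a"
    define T where "T = 2 * Re (cnj ?c * Complex (of_int A) (of_int B)) + Re (?c ^ 2) * P"
    have per: "period a = of_real ((- 1 - P * T) / 4)"
      using period_top[OF J a] unfolding Z T_def P_def
      by (simp add: field_simps)
    have neg: "cmod (1 + period a) - cmod (period a) = - 1" if "T \<ge> 1"
    proof -
      \<comment> \<open>As \<open>P\<close> is at least 5, an integral \<open>T\<close> of either
        sign keeps the period away from the gap between -1 and 0: here it is at most
        \<open>- 6 / 4\<close>, and for \<open>T \<le> - 1\<close> it is at least 1.\<close>
      have "5 * 1 \<le> P * T" using that P5 by (intro mult_mono) auto
      thus ?thesis unfolding per by (intro norm_diff_of_sign) auto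
    qed
    have pos: "cmod (1 + period a) - cmod (period a) = 1" if "T \<le> - 1"
    proof -
      have "5 * 1 \<le> P * (- T)" using that P5 by (intro mult_mono) auto
      thus ?thesis unfolding per by (intro norm_diff_of_sign) auto
    qed
    have "a \<in> F J" using a F_top by simp
    then obtain i :: nat where "?c = \<i> ^ i" using chi_cases[of J a] a by blast
    hence "?c = \<i> ^ (i mod 4)" by (simp add: i_power_mod)
    moreover have "i mod 4 \<in> {0, 1, 2, 3}" by auto
    ultimately consider "?c = 1" | "?c = \<i>" | "?c = - 1" | "?c = - \<i>"
      by (auto simp: power3_eq_cube)
    thus "cmod (1 + period a) - cmod (period a) = - (1 + Re (?c ^ 2)) / 2 + e * Im ?c"
    proof cases
      case 1
      hence "T = of_int (2 * A + P)" by (simp add: T_def)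
      moreover have "2 * A + P \<ge> 1" using A by (auto simp: P_def)
      ultimately have "T \<ge> 1" by (simp only: of_int_1_le_iff)
      thus ?thesis using neg 1 by simp
    next
      case 2
      hence T: "T = of_int (2 * B - P)" by (simp add: T_def)
      show ?thesis
      proof (cases "B > 0")
        case True
        hence "2 * B - P \<ge> 1" using B by simp
        hence "T \<ge> 1" unfolding T by (simp only: of_int_1_le_iff)
        thus ?thesis using neg 2 True by (simp add: e_def)
      next
        case False
        hence "2 * B - P \<le> - 1" using B P5 by simp
        hence "T \<le> - 1" unfolding T by (metis of_int_le_iff of_int_minus of_int_1)
        thus ?thesis using pos 2 False by (simp add: e_def)
      qed
    next
      case 3
      hence "T = of_int (P - 2 * A)" by (simp add: T_def)
      moreover have "P - 2 * A \<ge> 1" using A by (auto simp: P_def)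
      ultimately have "T \<ge> 1" by (simp only: of_int_1_le_iff)
      thus ?thesis using neg 3 by simp
    next
      case 4
      hence T: "T = of_int (- 2 * B - P)" by (simp add: T_def)
      show ?thesis
      proof (cases "B > 0")
        case True
        hence "- 2 * B - P \<le> - 1" using P5 by simp
        hence "T \<le> - 1" unfolding T by (metis of_int_le_iff of_int_minus of_int_1)
        thus ?thesis using pos 4 True by (simp add: e_def)
      next
        case False
        hence "- 2 * B - P \<ge> 1" using B by simp
        hence "T \<ge> 1" unfolding T by (simp only: of_int_1_le_iff)
        thus ?thesis using neg 4 False by (simp add: e_def)
      qed
    qed
  qed
qed

text \<open>By orthogonality \<open>chi J\<close> and its square sum to 0, so only the constant
  \<open>- 1 / 2\<close> of each term contributes.\<close>

lemma sum_norm_diff_period: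
  assumes J: "J = k + 2" and Z: "jacobi 0 ^ (2 ^ Suc k) = Complex (of_int A) (of_int B)"
    and A: "2 * \<bar>A\<bar> < int (q k)"
  shows "(\<Sum>a\<in>carrier R - {\<zero>}. cmod (1 + period a) - cmod (period a)) = - real (q J - 1) / 2"
proof -
  let ?S = "carrier R - {\<zero>}"
  obtain e :: real where e: "\<And>a. a \<in> carrier R \<Longrightarrow> a \<noteq> \<zero> \<Longrightarrow>
     cmod (1 + period a) - cmod (period a) = - (1 + Re (chi J a ^ 2)) / 2 + e * Im (chi J a)"
    using norm_diff_period[OF J Z A] by blast
  have card: "card ?S = q J - 1" using card_F[of J] F_top by simp
  have chi0: "(\<Sum>a\<in>?S. chi J a ^ m) = 0" if "\<i> ^ m \<noteq> (1::complex)" for m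
  proof -
    have "m \<noteq> 0" using that by (cases m) auto
    thus ?thesis
      using sum_chi_carrier[OF that] finite_carrier by (simp add: sum_diff1 chi_zero power_0_left)
  qed
  have "(\<Sum>a\<in>?S. cmod (1 + period a) - cmod (period a)) =
      (\<Sum>a\<in>?S. - (1 + Re (chi J a ^ 2)) / 2 + e * Im (chi J a))"
    by (intro sum.cong refl e) auto
  also have "\<dots> = (\<Sum>a\<in>?S. - 1 / 2 - Re (chi J a ^ 2) / 2 + e * Im (chi J a))"
    by (intro sum.cong refl) (simp add: field_simps)
  also have "\<dots> = - real (card ?S) / 2 - Re (\<Sum>a\<in>?S. chi J a ^ 2) / 2 + e * Im (\<Sum>a\<in>?S. chi J a)"
    unfolding sum.distrib sum_subtractf sum_constant sum_divide_distrib[symmetric]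
      sum_distrib_left[symmetric] Re_sum Im_sum by simp
  also have "\<dots> = - real (q J - 1) / 2"
    using chi0[of 2] chi0[of 1] i_power_ne_1 unfolding card by simp
  finally show ?thesis .
qed

end

section \<open>The energy of a Cayley graph\<close>

lemma proots_prod_linear: "proots (\<Prod>a\<leftarrow>xs. [:- a, 1:]) = mset (xs :: complex list)"
proof (induction xs)
  case (Cons a xs)
  have "proots ([:- a, 1:] * (\<Prod>a\<leftarrow>xs. [:- a, 1:])) =
      proots [:- a, 1:] + proots (\<Prod>a\<leftarrow>xs. [:- a, 1:])"
    by (rule proots_mult) (auto simp: prod_list_zero_iff)
  thus ?case unfolding Cons.IH proots_linear_factor by (simp del: mult_pCons_left)
qed simp

lemma sum_cmod_proots_similar_diagonal:
  fixes A :: "complex mat"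
  assumes "similar_mat A D" "D \<in> carrier_mat n n" "diagonal_mat D"
  shows "(\<Sum>\<mu>\<in>#proots (char_poly A). cmod \<mu>) = (\<Sum>i<n. cmod (D $$ (i, i)))"
proof -
  have "upper_triangular D"
    using assms(2,3) unfolding diagonal_mat_def upper_triangular_def by auto
  hence "char_poly A = (\<Prod>a\<leftarrow>diag_mat D. [:- a, 1:])"
    using char_poly_similar[OF assms(1)] char_poly_upper_triangular[OF assms(2)] by simp
  hence "(\<Sum>\<mu>\<in>#proots (char_poly A). cmod \<mu>) = sum_list (map cmod (diag_mat D))"
    by (simp add: proots_prod_linear sum_mset_sum_list flip: mset_map)
  also have "\<dots> = (\<Sum>i<n. cmod (D $$ (i, i)))"
    using assms(2) by (simp add: diag_mat_def sum_list_sum_nth o_def atLeast0LessThan)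
  finally show ?thesis .
qed

definition (in ring) cayley_graph :: "'a set \<Rightarrow> 'a pair_pre_digraph" where
  "cayley_graph S = \<lparr> pverts = carrier R,
     parcs = {(v, w) \<in> carrier R \<times> carrier R. w \<ominus> v \<in> S} \<rparr>"

text \<open>The columns of the character table \<open>U\<close> are eigenvectors of the adjacency
  matrix, with the character sums over \<open>S\<close> as eigenvalues. Orthogonality gives the
  inverse \<open>V\<close> of \<open>U\<close>, so the matrix is similar to the diagonal matrix
  \<open>D\<close>.\<close>

lemma (in cring) graph_energy_cayley_graph:
  fixes \<psi> :: "'a \<Rightarrow> complex"
  assumes fin: "finite (carrier R)" and S: "S \<subseteq> carrier R"
    and add: "\<And>x y. x \<in> carrier R \<Longrightarrow> y \<in> carrier R \<Longrightarrow> \<psi> (x \<oplus> y) = \<psi> x * \<psi> y"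
    and orth: "\<And>a. a \<in> carrier R \<Longrightarrow>
      (\<Sum>x\<in>carrier R. \<psi> (a \<otimes> x)) = (if a = \<zero> then of_nat (card (carrier R)) else 0)"
  shows "graph_energy (cayley_graph S) = (\<Sum>a\<in>carrier R. cmod (\<Sum>s\<in>S. \<psi> (a \<otimes> s)))"
proof -
  define n where "n = card (carrier R)"
  define e where "e = from_nat_into (carrier R)"
  define l where "l = (\<lambda>a. \<Sum>s\<in>S. \<psi> (a \<otimes> s))"
  have n0: "n > 0" unfolding n_def using fin by (auto simp: card_gt_0_iff)
  have e: "bij_betw e {0..<n} (carrier R)"
    unfolding e_def n_def atLeast0LessThan by (rule bij_betw_from_nat_into_finite[OF fin])
  have ec: "e i \<in> carrier R" if "i < n" for i using e that by (auto simp: bij_betw_def)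
  have einj: "e i = e j \<longleftrightarrow> i = j" if "i < n" "j < n" for i j
    using e that by (auto simp: bij_betw_def inj_on_def)
  have sum_e: "(\<Sum>i = 0..<n. f (e i)) = (\<Sum>x\<in>carrier R. f x)" for f :: "'a \<Rightarrow> complex"
    by (rule sum.reindex_bij_betw[OF e])
  define A where "A = adjacency_matrix (cayley_graph S)"
  define U where "U = mat n n (\<lambda>(i, k). \<psi> (e i \<otimes> e k))"
  define V where "V = mat n n (\<lambda>(k, j). \<psi> (\<ominus> (e k \<otimes> e j)) / of_nat n)"
  define D where "D = mat n n (\<lambda>(k, j). if k = j then l (e k) else 0)"
  have A: "A = mat n n (\<lambda>(i, j). if e j \<ominus> e i \<in> S then 1 else 0)"
    unfolding A_def adjacency_matrix_def cayley_graph_def e_def[symmetric] n_def[symmetric]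
    by (rule eq_matI) (auto simp: e_def[symmetric] n_def[symmetric] ec)
  have carr: "A \<in> carrier_mat n n" "U \<in> carrier_mat n n" "V \<in> carrier_mat n n" "D \<in> carrier_mat n n"
    by (auto simp: A U_def V_def D_def)
  have UV: "U * V = 1\<^sub>m n"
  proof (rule eq_matI)
    fix i j assume "i < dim_row (1\<^sub>m n :: complex mat)" "j < dim_col (1\<^sub>m n :: complex mat)"
    hence ij: "i < n" "j < n" by auto
    have "(U * V) $$ (i, j) = (\<Sum>k = 0..<n. \<psi> (e i \<otimes> e k) * (\<psi> (\<ominus> (e k \<otimes> e j)) / of_nat n))"
      using ij by (simp add: U_def V_def scalar_prod_def)
    also have "\<dots> = (\<Sum>k = 0..<n. \<psi> ((e i \<ominus> e j) \<otimes> e k) / of_nat n)"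
    proof (rule sum.cong[OF refl])
      fix k assume "k \<in> {0..<n}"
      hence c: "e i \<in> carrier R" "e j \<in> carrier R" "e k \<in> carrier R" using ij ec by auto
      have "(e i \<ominus> e j) \<otimes> e k = e i \<otimes> e k \<oplus> \<ominus> (e k \<otimes> e j)" using c by algebra
      thus "\<psi> (e i \<otimes> e k) * (\<psi> (\<ominus> (e k \<otimes> e j)) / of_nat n) = \<psi> ((e i \<ominus> e j) \<otimes> e k) / of_nat n"
        using c by (simp add: add)
    qed
    also have "\<dots> = (\<Sum>x\<in>carrier R. \<psi> ((e i \<ominus> e j) \<otimes> x)) / of_nat n"
      unfolding sum_divide_distrib[symmetric] sum_e[of "\<lambda>x. \<psi> ((e i \<ominus> e j) \<otimes> x)"] ..
    also have "\<dots> = (if i = j then 1 else 0)"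
      using ij n0 ec by (subst orth) (auto simp: n_def[symmetric] einj)
    finally show "(U * V) $$ (i, j) = 1\<^sub>m n $$ (i, j)" using ij by simp
  qed (use carr in auto)
  have AU: "A * U = U * D"
  proof (rule eq_matI)
    fix i k assume "i < dim_row (U * D)" "k < dim_col (U * D)"
    hence ik: "i < n" "k < n" using carr by auto
    hence c: "e i \<in> carrier R" "e k \<in> carrier R" using ec by auto
    have "(A * U) $$ (i, k) = (\<Sum>j = 0..<n. (if e j \<ominus> e i \<in> S then 1 else 0) * \<psi> (e j \<otimes> e k))"
      using ik by (simp add: A U_def scalar_prod_def)
    also have "\<dots> = (\<Sum>x\<in>carrier R. (if x \<ominus> e i \<in> S then 1 else 0) * \<psi> (x \<otimes> e k))"
      by (rule sum_e)
    also have "\<dots> = (\<Sum>x\<in>{x \<in> carrier R. x \<ominus> e i \<in> S}. \<psi> (x \<otimes> e k))"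
      unfolding sum.inter_filter[OF fin] by (intro sum.cong) auto
    also have "\<dots> = (\<Sum>s\<in>S. \<psi> (e i \<otimes> e k) * \<psi> (e k \<otimes> s))"
    proof (rule sum.reindex_bij_witness[of _ "\<lambda>s. e i \<oplus> s" "\<lambda>x. x \<ominus> e i"])
      fix x assume "x \<in> {x \<in> carrier R. x \<ominus> e i \<in> S}"
      hence x: "x \<in> carrier R" "x \<ominus> e i \<in> S" by auto
      show "e i \<oplus> (x \<ominus> e i) = x" using x(1) c by algebra
      show "x \<ominus> e i \<in> S" by fact
      have "x \<otimes> e k = e i \<otimes> e k \<oplus> e k \<otimes> (x \<ominus> e i)" using x(1) c by algebra
      thus "\<psi> (e i \<otimes> e k) * \<psi> (e k \<otimes> (x \<ominus> e i)) = \<psi> (x \<otimes> e k)"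
        using x c by (simp add: add)
    next
      fix s assume s: "s \<in> S"
      hence sc: "s \<in> carrier R" using S by blast
      show *: "e i \<oplus> s \<ominus> e i = s" using sc c by algebra
      show "e i \<oplus> s \<in> {x \<in> carrier R. x \<ominus> e i \<in> S}" using * s sc c by simp
    qed
    also have "\<dots> = \<psi> (e i \<otimes> e k) * l (e k)"
      by (simp add: l_def sum_distrib_left)
    also have "\<dots> = (\<Sum>j = 0..<n. \<psi> (e i \<otimes> e j) * (if j = k then l (e j) else 0))"
      using ik by (simp add: if_distrib[of "\<lambda>x. _ * x"] sum.delta cong: if_cong)
    also have "\<dots> = (U * D) $$ (i, k)"
      using ik by (simp add: D_def U_def scalar_prod_def)
    finally show "(A * U) $$ (i, k) = (U * D) $$ (i, k)" .
  qed (use carr in auto)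
  have "A = A * (U * V)" using carr by (simp add: UV)
  also have "\<dots> = U * D * V"
    unfolding AU[symmetric] by (rule assoc_mult_mat[OF carr(1,2,3), symmetric])
  finally have "similar_mat A D"
    using carr UV mat_mult_left_right_inverse[OF carr(2,3) UV]
    by (intro similar_matI[of _ _ U V n]) auto
  moreover have "diagonal_mat D" by (simp add: diagonal_mat_def D_def)
  ultimately have "graph_energy (cayley_graph S) = (\<Sum>i<n. cmod (D $$ (i, i)))"
    unfolding graph_energy_def A_def[symmetric]
    using carr(4) by (intro sum_cmod_proots_similar_diagonal)
  also have "\<dots> = (\<Sum>i = 0..<n. cmod (l (e i)))"
    by (simp add: D_def atLeast0LessThan)
  also have "\<dots> = (\<Sum>a\<in>carrier R. cmod (l a))"
    by (rule sum.reindex_bij_betw[OF e])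
  finally show ?thesis by (simp add: l_def)
qed

section \<open>Powers of a Gaussian prime with small real part\<close>

text \<open>
  The Jacobi sum depends on the field and on the chosen generator; uniqueness of the
  representation as a sum of two squares makes the condition on \<open>k\<close> independent of both.
\<close>

lemma two_squares_unique:
  fixes a b c d :: int
  assumes p: "prime p" and ab: "a\<^sup>2 + b\<^sup>2 = p" and cd: "c\<^sup>2 + d\<^sup>2 = p"
  shows "\<bar>a\<^sup>2 - b\<^sup>2\<bar> = \<bar>c\<^sup>2 - d\<^sup>2\<bar>"
proof -
  have p0: "p > 0" using p prime_gt_0_int by blast
  have key: "a\<^sup>2 = c\<^sup>2 \<or> a\<^sup>2 = d\<^sup>2"
    if dvd: "p dvd a * c - b * d" and cd: "c\<^sup>2 + d\<^sup>2 = p" for c d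
  proof -
    obtain m where m: "a * c - b * d = p * m" using dvd by blast
    \<comment> \<open>By Brahmagupta's identity a multiple of \<open>p ^ 2\<close> and a square add
      up to \<open>p ^ 2\<close>, so one of \<open>a * c - b * d\<close> and
      \<open>a * d + b * c\<close> is 0.\<close>
    have "(a * c - b * d)\<^sup>2 + (a * d + b * c)\<^sup>2 = (a\<^sup>2 + b\<^sup>2) * (c\<^sup>2 + d\<^sup>2)"
      by (simp add: power2_eq_square algebra_simps)
    hence sq: "p\<^sup>2 * m\<^sup>2 + (a * d + b * c)\<^sup>2 = p\<^sup>2"
      unfolding m ab cd by (simp add: power_mult_distrib power2_eq_square[of p])
    show ?thesis
    proof (cases "m = 0")
      case True
      hence "a * c = b * d" using m by simp
      hence "a\<^sup>2 * c\<^sup>2 = b\<^sup>2 * d\<^sup>2" by (metis power_mult_distrib)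
      moreover have "c\<^sup>2 = p - d\<^sup>2" "b\<^sup>2 = p - a\<^sup>2" using ab cd by auto
      ultimately have "p * a\<^sup>2 = p * d\<^sup>2" by (simp add: algebra_simps)
      thus ?thesis using p0 by simp
    next
      case False
      hence "1 \<le> m\<^sup>2" by (simp add: int_one_le_iff_zero_less)
      hence "p\<^sup>2 * 1 \<le> p\<^sup>2 * m\<^sup>2" by (intro mult_left_mono) auto
      hence "(a * d + b * c)\<^sup>2 = 0" using sq zero_le_power2[of "a * d + b * c"] by linarith
      hence "a * d = - b * c" by simp
      hence "a\<^sup>2 * d\<^sup>2 = b\<^sup>2 * c\<^sup>2" by (metis power_mult_distrib power2_minus)
      moreover have "d\<^sup>2 = p - c\<^sup>2" "b\<^sup>2 = p - a\<^sup>2" using ab cd by auto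
      ultimately have "p * a\<^sup>2 = p * c\<^sup>2" by (simp add: algebra_simps)
      thus ?thesis using p0 by simp
    qed
  qed
  \<comment> \<open>Since \<open>p\<close> divides this product, it divides one factor; the second
    is the first with \<open>- d\<close> in place of \<open>d\<close>, so \<open>key\<close> covers
    both cases.\<close>
  have "(a * c - b * d) * (a * c + b * d) = p * (a\<^sup>2 - d\<^sup>2)"
  proof -
    have "(a * c - b * d) * (a * c + b * d) = a\<^sup>2 * c\<^sup>2 - b\<^sup>2 * d\<^sup>2"
      by (simp add: power2_eq_square algebra_simps)
    also have "\<dots> = a\<^sup>2 * (p - d\<^sup>2) - (p - a\<^sup>2) * d\<^sup>2"
    proof -
      have "c\<^sup>2 = p - d\<^sup>2" "b\<^sup>2 = p - a\<^sup>2" using ab cd by auto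
      thus ?thesis by (simp only:)
    qed
    finally show ?thesis by (simp add: algebra_simps)
  qed
  hence "p dvd (a * c - b * d) * (a * c + b * d)" by simp
  hence "p dvd a * c - b * d \<or> p dvd a * c + b * d" using p prime_dvd_multD by blast
  hence "a\<^sup>2 = c\<^sup>2 \<or> a\<^sup>2 = d\<^sup>2" using key[of c d] key[of c "- d"] cd by auto
  thus ?thesis using ab cd by auto
qed

text \<open>
  If \<open>\<bar>c k\<bar> \<ge> 1/2\<close> from some point on, then \<open>c k \<ge> 1/2\<close> from there on, so that \<open>1 - c k\<close> at least
  triples in each step.
\<close>

lemma chebyshev_orbit_small:
  fixes c :: "nat \<Rightarrow> real"
  assumes step: "\<And>k. c (Suc k) = 2 * (c k)\<^sup>2 - 1"
    and bound: "\<And>k. \<bar>c k\<bar> \<le> 1" and ne1: "\<And>k. c k \<noteq> 1" and ne2: "\<And>k. c k \<noteq> - 1 / 2"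
  shows "infinite {k. \<bar>c k\<bar> < 1 / 2}"
proof
  assume "finite {k. \<bar>c k\<bar> < 1 / 2}"
  then obtain K where K: "\<And>k. \<bar>c k\<bar> < 1 / 2 \<Longrightarrow> k < K"
    unfolding finite_nat_set_iff_bounded by blast
  have big: "c k > 1 / 2 \<or> c k = 1 / 2" if "k \<ge> Suc K" for k
  proof -
    obtain j where j: "k = Suc j" "j \<ge> K" using \<open>k \<ge> Suc K\<close> by (cases k) auto
    have "1 / 2 \<le> \<bar>c j\<bar>" using K[of j] j by linarith
    hence "(1 / 2)\<^sup>2 \<le> \<bar>c j\<bar>\<^sup>2" by (intro power_mono) auto
    hence "c k \<ge> - 1 / 2" by (simp add: j step power2_eq_square)
    moreover have "\<bar>c k\<bar> \<ge> 1 / 2" using K[of k] that by force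
    ultimately show ?thesis using ne2[of k] by linarith
  qed
  define d where "d k = 1 - c (Suc K + k)" for k
  have d0: "d k > 0" for k using bound[of "Suc K + k"] ne1[of "Suc K + k"] by (simp add: d_def)
  \<comment> \<open>Here \<open>1 - (2 * c ^ 2 - 1) = 2 * (1 + c) * (1 - c)\<close>, and
    \<open>c \<ge> 1 / 2\<close> makes the factor \<open>2 * (1 + c)\<close> at least 3.\<close>
  have grow: "3 * d k \<le> d (Suc k)" for k
  proof -
    have "d (Suc k) = 2 * (1 + c (Suc K + k)) * d k"
      by (simp add: d_def step power2_eq_square algebra_simps)
    moreover have "3 * d k \<le> 2 * (1 + c (Suc K + k)) * d k"
      using d0[of k] big[of "Suc K + k"] by (intro mult_right_mono) auto
    ultimately show ?thesis by simp
  qed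
  have "3 ^ k * d 0 \<le> d k" for k
  proof (induction k)
    case (Suc k)
    thus ?case using grow[of k] by simp
  qed simp
  moreover have "d k \<le> 2" for k using bound[of "Suc K + k"] by (auto simp: d_def)
  moreover obtain k where "2 / d 0 < 3 ^ k" using real_arch_pow[of 3 "2 / d 0"] by auto
  ultimately show False using d0[of 0] by (metis divide_less_eq leD order_trans)
qed

lemma infinite_small_real_part:
  fixes p :: nat
  assumes p: "prime p" "p \<ge> 3" 
  shows "infinite {k. \<forall>a b :: int. a\<^sup>2 + b\<^sup>2 = int p \<longrightarrow>
    2 * \<bar>Re (Complex (of_int a) (of_int b) ^ (2 ^ Suc k))\<bar> < real (p ^ 2 ^ k)}"
\<comment> \<open>If \<open>p\<close> is not a sum of two squares, every \<open>k\<close> satisfies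
  the condition vacuously.\<close>
proof (cases "\<exists>a b :: int. a\<^sup>2 + b\<^sup>2 = int p")
  case False
  thus ?thesis by simp
next
  case True
  then obtain a b :: int where ab: "a\<^sup>2 + b\<^sup>2 = int p" by blast
  have pp: "prime (int p)" using p by simp
  define z where "z a b k = Complex (of_int a) (of_int b) ^ (2 ^ Suc k)" for a b :: int and k :: nat
  have norm: "(Re (z a b k))\<^sup>2 + (Im (z a b k))\<^sup>2 = (real (p ^ 2 ^ k))\<^sup>2"
    if "a\<^sup>2 + b\<^sup>2 = int p" for a b k
  proof -
    have "(cmod (Complex (of_int a) (of_int b)))\<^sup>2 = real_of_int (a\<^sup>2 + b\<^sup>2)"
      by (simp add: cmod_power2)
    hence "(cmod (Complex (of_int a) (of_int b)))\<^sup>2 = real p" by (simp add: that)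
    hence "((cmod (Complex (of_int a) (of_int b)))\<^sup>2) ^ (2 ^ Suc k) = real p ^ (2 ^ Suc k)" by simp
    thus ?thesis
      by (simp add: z_def cmod_power2[symmetric] norm_power power_mult[symmetric] mult.commute)
  qed
  have z_Suc: "Re (z a b (Suc k)) = 2 * (Re (z a b k))\<^sup>2 - (real (p ^ 2 ^ k))\<^sup>2"
    if "a\<^sup>2 + b\<^sup>2 = int p" for a b k
  proof -
    have "z a b (Suc k) = (z a b k)\<^sup>2" by (simp add: z_def power_mult[symmetric] mult.commute)
    thus ?thesis using norm[OF that, of k] by (simp add: Re_power2)
  qed
  \<comment> \<open>At \<open>k = 0\<close> the real part is \<open>a ^ 2 - b ^ 2\<close>, settled
    by \<open>two_squares_unique\<close>. The recursion \<open>z_Suc\<close> depends only on the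
    square of the real part, so the agreement persists.\<close>
  have indep: "\<bar>Re (z a' b' k)\<bar> = \<bar>Re (z a b k)\<bar>" if "a'\<^sup>2 + b'\<^sup>2 = int p" for a' b' k
  proof (induction k)
    case 0
    have "\<bar>real_of_int (a'\<^sup>2 - b'\<^sup>2)\<bar> = \<bar>real_of_int (a\<^sup>2 - b\<^sup>2)\<bar>"
      using two_squares_unique[OF pp that ab] by (metis of_int_abs)
    thus ?case by (simp add: z_def Re_power2)
  next
    case (Suc k)
    hence "(Re (z a' b' k))\<^sup>2 = (Re (z a b k))\<^sup>2" by (metis power2_abs)
    thus ?case by (simp add: z_Suc[OF that] z_Suc[OF ab])
  qed
  \<comment> \<open>This excludes the values 1 and \<open>- 1 / 2\<close> of \<open>c\<close>, at
    which \<open>n\<close> or \<open>2 * n\<close> would be a power of \<open>p\<close> up to sign.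
    In the base case, divisibility would force \<open>p\<close> to divide both \<open>a\<close> and
    \<open>b\<close>, hence \<open>p ^ 2\<close> to divide \<open>p\<close>.\<close>
  have int: "\<exists>n. Re (z a b k) = of_int n \<and> \<not> int p dvd n" for k
  proof (induction k)
    case 0
    have "\<not> int p dvd a\<^sup>2 - b\<^sup>2"
    proof
      assume "int p dvd a\<^sup>2 - b\<^sup>2"
      moreover have "2 * a\<^sup>2 = (a\<^sup>2 - b\<^sup>2) + int p" using ab by simp
      ultimately have "int p dvd 2 * a\<^sup>2" by (metis dvd_add dvd_refl)
      moreover have "\<not> int p dvd 2" using p by (auto dest: zdvd_imp_le)
      ultimately have "int p dvd a" using pp by (metis prime_dvd_multD prime_dvd_power)
      hence "(int p)\<^sup>2 dvd a\<^sup>2" by (simp add: dvd_power_same)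
      moreover have "int p dvd b\<^sup>2" using ab \<open>int p dvd a\<close>
        by (metis add_diff_cancel_left' dvd_diff dvd_refl dvd_power_same dvd_trans dvd_power zero_less_numeral)
      hence "int p dvd b" using pp prime_dvd_power by blast
      hence "(int p)\<^sup>2 dvd b\<^sup>2" by (simp add: dvd_power_same)
      ultimately have "(int p)\<^sup>2 dvd int p" using ab by (metis dvd_add)
      hence "int p * int p \<le> int p" using p by (auto dest!: zdvd_imp_le simp: power2_eq_square)
      thus False using p by simp
    qed
    thus ?case by (intro exI[of _ "a\<^sup>2 - b\<^sup>2"]) (simp add: z_def Re_power2)
  next
    case (Suc k)
    then obtain n where n: "Re (z a b k) = of_int n" "\<not> int p dvd n" by blast
    have "\<not> int p dvd 2 * n\<^sup>2 - (int p ^ 2 ^ k)\<^sup>2"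
    proof
      assume *: "int p dvd 2 * n\<^sup>2 - (int p ^ 2 ^ k)\<^sup>2"
      have "int p dvd (int p ^ 2 ^ k)\<^sup>2" by (simp add: power_mult[symmetric] dvd_power)
      hence "int p dvd 2 * n\<^sup>2" using * by (metis diff_add_cancel dvd_add)
      moreover have "\<not> int p dvd 2" using p by (auto dest: zdvd_imp_le)
      ultimately show False using n(2) pp by (metis prime_dvd_multD prime_dvd_power)
    qed
    thus ?case unfolding z_Suc[OF ab] n(1) by (intro exI[of _ "2 * n\<^sup>2 - (int p ^ 2 ^ k)\<^sup>2"]) simp
  qed
  define c where "c k = Re (z a b k) / real (p ^ 2 ^ k)" for k
  have p0: "real (p ^ 2 ^ k) > 0" for k using p by simp
  have "infinite {k. \<bar>c k\<bar> < 1 / 2}"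
  proof (rule chebyshev_orbit_small)
    fix k
    show "c (Suc k) = 2 * (c k)\<^sup>2 - 1"
    proof -
      have "real (p ^ 2 ^ Suc k) = (real (p ^ 2 ^ k))\<^sup>2" by (simp add: power_mult[symmetric] mult.commute)
      thus ?thesis unfolding c_def z_Suc[OF ab] using p0[of k] by (simp add: power_divide diff_divide_distrib)
    qed
    have "(Re (z a b k))\<^sup>2 \<le> (real (p ^ 2 ^ k))\<^sup>2" using norm[OF ab, of k] by (metis le_add_same_cancel1 zero_le_power2)
    hence "\<bar>Re (z a b k)\<bar> \<le> real (p ^ 2 ^ k)" by (metis abs_le_square_iff abs_of_nat)
    thus "\<bar>c k\<bar> \<le> 1" using p0[of k] by (simp add: c_def abs_divide)
    obtain n where n: "Re (z a b k) = of_int n" "\<not> int p dvd n" using int by blast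
    have pd: "int p dvd int p ^ 2 ^ k" by (simp add: dvd_power)
    show "c k \<noteq> 1"
    proof
      assume "c k = 1"
      hence "real_of_int n = real_of_int (int p ^ 2 ^ k)" using p0[of k] n by (simp add: c_def)
      hence "n = int p ^ 2 ^ k" by (simp only: of_int_eq_iff)
      thus False using n(2) pd by simp
    qed
    show "c k \<noteq> - 1 / 2"
    proof
      assume "c k = - 1 / 2"
      hence "real_of_int (2 * n) = real_of_int (- (int p ^ 2 ^ k))"
        using p0[of k] n by (simp add: c_def field_simps)
      hence "2 * n = - (int p ^ 2 ^ k)" by (simp only: of_int_eq_iff)
      hence "int p dvd 2 * n" using pd by simp
      moreover have "\<not> int p dvd 2" using p by (auto dest: zdvd_imp_le)
      ultimately show False using n(2) pp prime_dvd_multD by blast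
    qed
  qed
  moreover have "{k. \<bar>c k\<bar> < 1 / 2} \<subseteq> {k. \<forall>a b :: int. a\<^sup>2 + b\<^sup>2 = int p \<longrightarrow>
    2 * \<bar>Re (Complex (of_int a) (of_int b) ^ (2 ^ Suc k))\<bar> < real (p ^ 2 ^ k)}"
    unfolding z_def[symmetric]
  proof (intro subsetI CollectI allI impI)
    fix k and a' b' :: int assume k: "k \<in> {k. \<bar>c k\<bar> < 1 / 2}" and "a'\<^sup>2 + b'\<^sup>2 = int p"
    hence "\<bar>Re (z a' b' k)\<bar> = \<bar>Re (z a b k)\<bar>" using indep by blast
    moreover have "2 * \<bar>Re (z a b k)\<bar> < real (p ^ 2 ^ k)"
      using k p0[of k] by (simp add: c_def abs_divide field_simps)
    ultimately show "2 * \<bar>Re (z a' b' k)\<bar> < real (p ^ 2 ^ k)" by simp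
  qed
  ultimately show ?thesis using finite_subset by blast
qed

section \<open>Equienergetic residue graphs\<close>

lemma (in ring) complement_cayley_graph:
  "complement_graph (cayley_graph S) = cayley_graph (carrier R - {\<zero>} - S)"
  unfolding complement_graph_def cayley_graph_def by auto

context quartic_tower
begin

lemma equienergetic_residue_graph:
  assumes J: "J = k + 2"
    and small: "\<And>a b :: int. a\<^sup>2 + b\<^sup>2 = int p \<Longrightarrow>
      2 * \<bar>Re (Complex (of_int a) (of_int b) ^ (2 ^ Suc k))\<bar> < real (p ^ 2 ^ k)"
  shows "equienergetic (residue_graph 4 R) (complement_graph (residue_graph 4 R))"
proof -
  let ?S = "power_residues 4 R"
  let ?T = "carrier R - {\<zero>} - ?S"
  have S: "?S \<subseteq> carrier R - {\<zero>}"
    using chi_zero[of J] by (auto simp: power_residues_4)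
  have card: "card (carrier R) = q J" using card_F[of J] F_top by simp
  have orth: "(\<Sum>x\<in>carrier R. psi J (a \<otimes> x)) = (if a = \<zero> then of_nat (card (carrier R)) else 0)"
    if "a \<in> carrier R" for a
    using sum_psi_mult[of J a] that F_top card by simp
  have energy: "graph_energy (cayley_graph S) = (\<Sum>a\<in>carrier R. cmod (\<Sum>s\<in>S. psi J (a \<otimes> s)))"
    if "S \<subseteq> carrier R" for S
    using that orth psi_add[of _ J] F_top
    by (intro graph_energy_cayley_graph finite_carrier) auto
  define n where "n = card ?S"
  have n: "q J = 4 * n + 1" using card_power_residues q_ge_5[of J] by (simp add: n_def)
  \<comment> \<open>The connection set of the complement is everything except \<open>\<zero>\<close>
    and the fourth powers; \<open>\<zero>\<close> contributes the 1.\<close>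
  have compl: "(\<Sum>s\<in>?T. psi J (a \<otimes> s)) = (if a = \<zero> then of_nat (q J) else 0) - 1 - period a"
    if a: "a \<in> carrier R" for a
  proof -
    have "(\<Sum>s\<in>?T. psi J (a \<otimes> s)) = (\<Sum>s\<in>carrier R - {\<zero>}. psi J (a \<otimes> s)) - period a"
      unfolding period_def using S finite_carrier by (intro sum_diff) auto
    also have "(\<Sum>s\<in>carrier R - {\<zero>}. psi J (a \<otimes> s)) = (\<Sum>s\<in>carrier R. psi J (a \<otimes> s)) - 1"
      using a finite_carrier by (simp add: sum_diff1 psi_zero)
    finally show ?thesis using orth[OF a] card by simp
  qed
  have E1: "graph_energy (cayley_graph ?S) = (\<Sum>a\<in>carrier R. cmod (period a))"
    unfolding period_def using S by (intro energy) auto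
  have E2: "graph_energy (cayley_graph ?T) =
      (\<Sum>a\<in>carrier R. cmod ((if a = \<zero> then of_nat (q J) else 0) - 1 - period a))"
    by (subst energy) (auto simp: compl)
  have split: "(\<Sum>a\<in>carrier R. f a) = f \<zero> + (\<Sum>a\<in>carrier R - {\<zero>}. f a)" for f :: "'a \<Rightarrow> real"
    using finite_carrier by (intro sum.remove) auto
  have "period \<zero> = of_nat n"
    unfolding period_def n_def using S by (subst sum.cong[OF refl, of _ _ "\<lambda>_. 1"]) (auto simp: psi_zero)
  moreover have "cmod (- 1 - z) = cmod (1 + z)" for z
    using norm_minus_cancel[of "1 + z"] by simp
  \<comment> \<open>The term at \<open>\<zero>\<close> compares the degrees \<open>3 * n\<close> and
    \<open>n\<close>. Their difference \<open>2 * n\<close> cancels against the sum over the nonzero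
    elements, which is \<open>- (q J - 1) / 2 = - 2 * n\<close>.\<close>
  ultimately have "graph_energy (cayley_graph ?T) - graph_energy (cayley_graph ?S) =
      cmod (of_nat (q J) - 1 - of_nat n) - real n +
      (\<Sum>a\<in>carrier R - {\<zero>}. cmod (1 + period a) - cmod (period a))"
    unfolding E1 E2 split[of "\<lambda>a. cmod (period a)"]
      split[of "\<lambda>a. cmod ((if a = \<zero> then of_nat (q J) else 0) - 1 - period a)"]
    by (simp add: sum_subtractf)
  also have "complex_of_nat (q J) - 1 - of_nat n = of_nat (3 * n)" by (simp add: n)
  also have "(\<Sum>a\<in>carrier R - {\<zero>}. cmod (1 + period a) - cmod (period a)) = - real (q J - 1) / 2"
  proof -
    \<comment> \<open>The Jacobi sum of the prime field is a Gaussian integer of norm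
      \<open>p\<close>, so \<open>small\<close> applies whichever one the field and the generator
      produce.\<close>
    have jac: "jacobi 0 \<in> gaussian_ints" using jacobi_gaussian by simp
    then obtain a b :: int where ab: "jacobi 0 = Complex (of_int a) (of_int b)"
      by (auto simp: gaussian_ints_def)
    have "real_of_int (a\<^sup>2 + b\<^sup>2) = real_of_int (int p)"
      using norm_jacobi[of 0] by (simp add: ab cmod_power2 q_def)
    hence "a\<^sup>2 + b\<^sup>2 = int p" by (simp only: of_int_eq_iff)
    hence sm: "2 * \<bar>Re (jacobi 0 ^ (2 ^ Suc k))\<bar> < real (q k)" 
      unfolding ab q_def by (rule small)
    obtain A B :: int where AB: "jacobi 0 ^ (2 ^ Suc k) = Complex (of_int A) (of_int B)"
      using gaussian_ints_power[OF jac, of "2 ^ Suc k"] unfolding gaussian_ints_def by blast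
    have "real_of_int (2 * \<bar>A\<bar>) < real_of_int (int (q k))" using sm unfolding AB by simp
    hence "2 * \<bar>A\<bar> < int (q k)" by (simp only: of_int_less_iff)
    thus ?thesis by (rule sum_norm_diff_period[OF J AB])
  qed
  finally have "graph_energy (cayley_graph ?T) = graph_energy (cayley_graph ?S)"
    by (simp only: norm_of_nat) (simp add: n)
  moreover have "residue_graph 4 R = cayley_graph ?S"
    by (simp add: residue_graph_def cayley_graph_def)
  ultimately show ?thesis
    by (simp add: equienergetic_def complement_cayley_graph)
qed

end

theorem theorem5p3:
  fixes p :: nat
  assumes "prime p" and "[p = 1] (mod 4)"
  shows "infinite {l :: nat. \<forall>F :: 'a ring. field F \<and> card (carrier F) = p ^ (4 * l) \<longrightarrow>
    equienergetic (residue_graph 4 F) (complement_graph (residue_graph 4 F))}"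
proof -
  have p4: "p mod 4 = 1" using assms(2) by (simp add: cong_def)
  hence "p \<noteq> 2" by auto
  hence p3: "p \<ge> 3" using prime_ge_2_nat[OF assms(1)] by linarith
  \<comment> \<open>The condition mentions only \<open>p\<close> and \<open>k\<close>, so one set of
    exponents serves all fields of the given order.\<close>
  define K where "K = {k. \<forall>a b :: int. a\<^sup>2 + b\<^sup>2 = int p \<longrightarrow>
    2 * \<bar>Re (Complex (of_int a) (of_int b) ^ (2 ^ Suc k))\<bar> < real (p ^ 2 ^ k)}"
  have "infinite K" unfolding K_def by (rule infinite_small_real_part[OF assms(1) p3])
  moreover have "inj_on (\<lambda>k. (2::nat) ^ k) K" by (rule inj_onI) simp
  ultimately have "infinite ((\<lambda>k. (2::nat) ^ k) ` K)" by (simp add: finite_image_iff)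
  moreover have "(\<lambda>k. 2 ^ k) ` K \<subseteq>
    {l. \<forall>F :: 'a ring. field F \<and> card (carrier F) = p ^ (4 * l) \<longrightarrow>
      equienergetic (residue_graph 4 F) (complement_graph (residue_graph 4 F))}"
  proof (intro subsetI CollectI allI impI)
    fix l and F :: "'a ring"
    assume "l \<in> (\<lambda>k. 2 ^ k) ` K" and F: "field F \<and> card (carrier F) = p ^ (4 * l)"
    then obtain k where k: "k \<in> K" "l = 2 ^ k" by blast
    \<comment> \<open>Thus the field is the top of a tower of height \<open>k + 2\<close>, the form
      required by \<open>gauss_tower\<close>.\<close>
    have "4 * l = 2 ^ (k + 2)" by (simp add: k power_add)
    hence "quartic_tower F p (k + 2)"
      using F assms(1) p4
      by (simp add: quartic_tower_def prime_power_field_def prime_power_field_axioms_def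
          quartic_tower_axioms_def)
    thus "equienergetic (residue_graph 4 F) (complement_graph (residue_graph 4 F))"
      by (rule quartic_tower.equienergetic_residue_graph[OF _ refl]) (use k(1) in \<open>simp add: K_def\<close>)
  qed
  ultimately show ?thesis using finite_subset by blast
qed

end
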